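(* Let $\varphi,\psi:\Sigma\to\mathbb{R}$ be Hölder continuous with $\psi>0$, and let $C_{\Sigma,\sigma}$ denote the set of compact $\sigma$-invariant subsets of $\Sigma$. Then: (1) $\sup_{K\in C_{\Sigma,\sigma}}\mathcal{P}_{\psi,K}(\varphi,\Sigma(a)^* )=\mathcal{P}_\psi(\varphi,\Sigma_a^{\mathrm{per}})$ for $a\in I$. (2) $\sup_{K\in C_{\Sigma,\sigma}}\mathcal{P}_{\psi,K}(\varphi,\Sigma^* )=\sup_{a\in I}\mathcal{P}_\psi(\varphi,\Sigma_a^{\mathrm{per}})$. In particular, if $\Sigma$ is irreducible (for all $i,j\in I$ there is $\omega\in\Sigma^*$ with $i\omega j\in\Sigma^*$), then for every $a\in I$ $$\sup_{K\in C_{\Sigma,\sigma}}\mathcal{P}_{\psi,K}(\varphi,\Sigma^* )=\mathcal{P}_\psi(\varphi,\Sigma_a^{\mathrm{per}}),$$ and $(\psi,\varphi,\Sigma^* )$ satisfies the exhausting principle if and only if $\mathcal{P}_\psi(\varphi,\Sigma^* )=\mathcal{P}_\psi(\varphi,\Sigma_a^{\mathrm{per}})$.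
   Context: Markov shift: $I\subset\mathbb{N}$ is an alphabet (finite or infinite), $A\in\{0,1\}^{I\times I}$ an incidence matrix, $\Sigma=\{\omega\in I^{\mathbb{N}}: A_{\omega_i\omega_{i+1}}=1\ \forall i\in\mathbb N\}$, $\sigma$ the left shift. $\Sigma^*$ is the set of all finite non-empty words over $I$ whose consecutive letters $ij$ satisfy $A_{ij}=1$; $|\omega|$ is the length of $\omega\in\Sigma^*$; $[\omega]=\{\tau\in\Sigma:\tau\text{ begins with }\omega\}$. $\Sigma$ is topologized by the metrics $d_\alpha(\omega,\omega')=e^{-\alpha|\omega\wedge\omega'|}$, $\alpha>0$, where $\omega\wedge\omega'$ is the longest common initial block. Hölder continuity: $f:\Sigma\to\mathbb{R}$ is Hölder continuous if there are $\alpha>0$ and $V\ge0$ with $|f(\omega)-f(\omega')|\le V d_\alpha(\omega,\omega')$ for all $\omega,\omega'\in\Sigma$ with $|\omega\wedge\omega'|\ge1$. Induced pressure ($\mathcal{C}\subset\Sigma^*$): $$\mathcal{P}_\psi(\varphi,\mathcal{C})=\limsup_{T\to\infty}\frac1T\log\sum_{\omega\in\mathcal{C},\ T-\eta<S_\omega\psi\le T}\exp S_\omega\varphi\in[-\infty,\infty],\qquad S_\omega f=\sup_{\tau\in[\omega]}\sum_{k=0}^{|\omega|-1}f(\sigma^k\tau),$$ where $\eta>0$ is any fixed number (the value does not depend on $\eta$), and $\log 0=-\infty$, $\sup\emptyset=-\infty$. For a $\sigma$-invariant $K\subset\Sigma$, $K^*=\{\omega\in\Sigma^*:[\omega]\cap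 K\ne\emptyset\}$ and $\mathcal{P}_{\psi,K}(\varphi,\mathcal{C})=\mathcal{P}_{\psi|_K}(\varphi|_K,\mathcal{C}\cap K^* )$, where in the latter the suprema in $S_\omega$ are over $[\omega]\cap K$. The exhausting principle holds for $(\psi,\varphi,\mathcal{C})$ if there is a sequence $(K_n)$ of compact $\sigma$-invariant subsets of $\Sigma$ with $\lim_{n\to\infty}\mathcal{P}_{\psi,K_n}(\varphi,\mathcal{C})=\mathcal{P}_\psi(\varphi,\mathcal{C})$. For $a\in I$: $\Sigma_a^{\mathrm{per}}=\{\omega\in\Sigma^*:\omega_1=a,\ \overline\omega\in\Sigma\}$ with $\overline\omega=\omega\omega\omega\cdots$. Write $a\curvearrowright b$ if there is $\tau\in\Sigma^*$ with $a\tau b\in\Sigma^*$. The irreducible component of $\Sigma$ containing $a$ is $\Sigma(a)=\{\omega\in\Sigma:a\curvearrowright\omega_1\text{ and }\omega_i\curvearrowright a\ \forall i\in\mathbb{N}\}$, and $\Sigma(a)^*=\{\omega\in\Sigma^*:[\omega]\cap\Sigma(a)\ne\emptyset\}$. *)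

theory Defs
  imports "HOL-Analysis.Analysis"
begin

section \<open>The shift space\<close>

text \<open>
  The alphabet is a set \<open>I\<close> of natural numbers; the incidence matrix is given by a relation
  \<open>A\<close>, where \<open>A i j\<close> stands for $A_{ij} = 1$. Infinite sequences are functions on \<open>nat\<close>, so the
  first letter of \<open>x\<close> is \<open>x 0\<close>; finite words are lists.
\<close>

definition shift_space :: "nat set \<Rightarrow> (nat \<Rightarrow> nat \<Rightarrow> bool) \<Rightarrow> (nat \<Rightarrow> nat) set" where
  "shift_space I A = {x. \<forall>i. x i \<in> I \<and> A (x i) (x (Suc i))}"

definition shift :: "(nat \<Rightarrow> nat) \<Rightarrow> (nat \<Rightarrow> nat)" where
  "shift x = (\<lambda>i. x (Suc i))"

definition words :: "nat set \<Rightarrow> (nat \<Rightarrow> nat \<Rightarrow> bool) \<Rightarrow> nat list set" where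
  "words I A = {w. w \<noteq> [] \<and> set w \<subseteq> I \<and> successively A w}"

definition cylinder :: "nat set \<Rightarrow> (nat \<Rightarrow> nat \<Rightarrow> bool) \<Rightarrow> nat list \<Rightarrow> (nat \<Rightarrow> nat) set" where
  "cylinder I A w = {x \<in> shift_space I A. \<forall>i<length w. x i = w ! i}"

definition common_length :: "(nat \<Rightarrow> nat) \<Rightarrow> (nat \<Rightarrow> nat) \<Rightarrow> enat" where
  "common_length x y = (SUP n\<in>{n. \<forall>i<n. x i = y i}. enat n)"

definition d_shift :: "real \<Rightarrow> (nat \<Rightarrow> nat) \<Rightarrow> (nat \<Rightarrow> nat) \<Rightarrow> real" where
  "d_shift \<alpha> x y = (case common_length x y of enat n \<Rightarrow> exp (- \<alpha> * real n) | \<infinity> \<Rightarrow> 0)"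

text \<open>
  All the metrics \<open>d_shift \<alpha>\<close> with \<open>\<alpha> > 0\<close> induce the same topology (see \<open>mtopology_d_shift\<close>
  below); the definition uses \<open>\<alpha> = 1\<close>.
\<close>

definition shift_topology :: "nat set \<Rightarrow> (nat \<Rightarrow> nat \<Rightarrow> bool) \<Rightarrow> (nat \<Rightarrow> nat) topology" where
  "shift_topology I A = Metric_space.mtopology (shift_space I A) (d_shift 1)"

lemma common_length_ge_iff: "enat n \<le> common_length x y \<longleftrightarrow> (\<forall>i<n. x i = y i)"
proof
  assume le: "enat n \<le> common_length x y"
  show "\<forall>i<n. x i = y i"
  proof (rule ccontr)
    assume "\<not> (\<forall>i<n. x i = y i)"
    then obtain i where i: "i < n" "x i \<noteq> y i" by blast
    have "common_length x y \<le> enat i"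
      unfolding common_length_def
    proof (rule SUP_least)
      fix m assume "m \<in> {n. \<forall>i<n. x i = y i}"
      then have "\<not> i < m" using i(2) by blast
      then show "enat m \<le> enat i" by simp
    qed
    with le have "enat n \<le> enat i" by (rule order_trans)
    with i show False by simp
  qed
next
  assume "\<forall>i<n. x i = y i"
  then show "enat n \<le> common_length x y"
    unfolding common_length_def by (auto intro: SUP_upper)
qed

lemma common_length_eq_infinity_iff: "common_length x y = \<infinity> \<longleftrightarrow> x = y"
proof
  assume "common_length x y = \<infinity>"
  then have "\<forall>i<n. x i = y i" for n using common_length_ge_iff[of n x y] by simp
  then show "x = y" by blast
next
  assume "x = y"
  then have le: "enat n \<le> common_length x y" for n by (simp add: common_length_ge_iff)
  show "common_length x y = \<infinity>"
  proof (cases "common_length x y")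
    case (enat m)
    then show ?thesis using le[of "Suc m"] by simp
  qed
qed

lemma common_length_commute: "common_length x y = common_length y x"
  unfolding common_length_def by (simp add: eq_commute)

lemma common_length_triangle:
  "min (common_length x y) (common_length y z) \<le> common_length x z"
proof (cases "min (common_length x y) (common_length y z)")
  case (enat n)
  then have "enat n \<le> common_length x y" "enat n \<le> common_length y z"
    by (metis min.cobounded1) (metis enat min.cobounded2)
  then show ?thesis
    unfolding enat by (simp add: common_length_ge_iff)
next
  case infinity
  then have "common_length x y = \<infinity>" "common_length y z = \<infinity>"
    by (auto simp: min_def split: if_splits)
  then show ?thesis by (simp add: common_length_eq_infinity_iff)
qed

lemma d_shift_antimono:
  assumes "\<alpha> > 0" "common_length x y \<le> common_length u v"
  shows "d_shift \<alpha> u v \<le> d_shift \<alpha> x y"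
  using assms by (cases "common_length x y"; cases "common_length u v") (simp_all add: d_shift_def)

lemma Metric_space_d_shift:
  assumes "\<alpha> > 0"
  shows "Metric_space M (d_shift \<alpha>)"
proof
  have nonneg: "0 \<le> d_shift \<alpha> x y" for x y
    by (simp add: d_shift_def split: enat.splits)
  then show "0 \<le> d_shift \<alpha> x y" for x y .
  show "d_shift \<alpha> x y = d_shift \<alpha> y x" for x y
    by (simp add: d_shift_def common_length_commute)
  show "d_shift \<alpha> x y = 0 \<longleftrightarrow> x = y" for x y
    using common_length_eq_infinity_iff[of x y]
    by (auto simp: d_shift_def split: enat.splits)
  show "d_shift \<alpha> x z \<le> d_shift \<alpha> x y + d_shift \<alpha> y z" for x y z
  proof -
    have "common_length x y \<le> common_length x z \<or> common_length y z \<le> common_length x z"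
      using common_length_triangle[of x y z] by (auto simp: min_def split: if_splits)
    then have "d_shift \<alpha> x z \<le> d_shift \<alpha> x y \<or> d_shift \<alpha> x z \<le> d_shift \<alpha> y z"
      using d_shift_antimono[OF assms] by blast
    then show ?thesis using nonneg[of x y] nonneg[of y z] by linarith
  qed
qed

lemma d_shift_powr:
  assumes "\<alpha> > 0"
  shows "d_shift \<beta> x y = d_shift \<alpha> x y powr (\<beta> / \<alpha>)"
  using assms by (auto simp: d_shift_def exp_powr_real split: enat.splits)

lemma mtopology_d_shift:
  assumes \<alpha>: "\<alpha> > 0"
  shows "Metric_space.mtopology (shift_space I A) (d_shift \<alpha>) = shift_topology I A"
proof -
  have le: "openin (Metric_space.mtopology M (d_shift c)) U"
    if c: "c > 0" and b: "b > 0" and U: "openin (Metric_space.mtopology M (d_shift b)) U"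
    for b c M U
  proof -
    interpret B: Metric_space M "d_shift b" by (rule Metric_space_d_shift[OF b])
    interpret C: Metric_space M "d_shift c" by (rule Metric_space_d_shift[OF c])
    have "U \<subseteq> M" using U by (simp add: B.openin_mtopology)
    moreover have "\<exists>r>0. C.mball x r \<subseteq> U" if x: "x \<in> U" for x
    proof -
      obtain r where r: "r > 0" "B.mball x r \<subseteq> U"
        using U x by (auto simp: B.openin_mtopology)
      have "C.mball x (r powr (c / b)) \<subseteq> B.mball x r"
      proof
        fix y assume y: "y \<in> C.mball x (r powr (c / b))"
        then have "d_shift b x y powr (c / b) < r powr (c / b)"
          by (simp add: C.in_mball d_shift_powr[OF b, of c])
        then have "d_shift b x y < r"
          using b c r by (smt (verit) divide_pos_pos powr_mono2)
        with y show "y \<in> B.mball x r" by simp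
      qed
      with r show ?thesis by (intro exI[of _ "r powr (c / b)"]) auto
    qed
    ultimately show ?thesis by (simp add: C.openin_mtopology)
  qed
  show ?thesis
    unfolding shift_topology_def topology_eq using le \<alpha> by (meson zero_less_one)
qed

definition holder_continuous ::
    "nat set \<Rightarrow> (nat \<Rightarrow> nat \<Rightarrow> bool) \<Rightarrow> ((nat \<Rightarrow> nat) \<Rightarrow> real) \<Rightarrow> bool" where
  "holder_continuous I A f \<longleftrightarrow>
     (\<exists>\<alpha>>0. \<exists>V\<ge>0. \<forall>x\<in>shift_space I A. \<forall>y\<in>shift_space I A.
        common_length x y \<ge> 1 \<longrightarrow> \<bar>f x - f y\<bar> \<le> V * d_shift \<alpha> x y)"

text \<open>Invariance is forward invariance, $\sigma(K) \subseteq K$.\<close>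

definition invariant :: "(nat \<Rightarrow> nat) set \<Rightarrow> bool" where
  "invariant K \<longleftrightarrow> shift ` K \<subseteq> K"

definition compact_invariant ::
    "nat set \<Rightarrow> (nat \<Rightarrow> nat \<Rightarrow> bool) \<Rightarrow> (nat \<Rightarrow> nat) set set" where
  "compact_invariant I A = {K. compactin (shift_topology I A) K \<and> invariant K}"

section \<open>Induced pressure\<close>

definition eexp :: "ereal \<Rightarrow> ennreal" where
  "eexp x = (case x of ereal r \<Rightarrow> ennreal (exp r) | PInfty \<Rightarrow> \<infinity> | MInfty \<Rightarrow> 0)"

definition elog :: "ennreal \<Rightarrow> ereal" where
  "elog x = (if x = 0 then -\<infinity> else if x = \<infinity> then \<infinity> else ereal (ln (enn2real x)))"

text \<open>
  The set \<open>X\<close> is the system on which the functions are considered: the whole shift space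
  or an invariant subset of it, the supremum being taken over the part of the cylinder in \<open>X\<close>.
\<close>

definition birkhoff_sup ::
    "nat set \<Rightarrow> (nat \<Rightarrow> nat \<Rightarrow> bool) \<Rightarrow> (nat \<Rightarrow> nat) set \<Rightarrow> ((nat \<Rightarrow> nat) \<Rightarrow> real)
      \<Rightarrow> nat list \<Rightarrow> ereal" where
  "birkhoff_sup I A X f w =
     (SUP x\<in>cylinder I A w \<inter> X. ereal (\<Sum>k<length w. f ((shift ^^ k) x)))"

definition pressure_within ::
    "nat set \<Rightarrow> (nat \<Rightarrow> nat \<Rightarrow> bool) \<Rightarrow> (nat \<Rightarrow> nat) set \<Rightarrow> real
      \<Rightarrow> ((nat \<Rightarrow> nat) \<Rightarrow> real) \<Rightarrow> ((nat \<Rightarrow> nat) \<Rightarrow> real) \<Rightarrow> nat list set \<Rightarrow> ereal" where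
  "pressure_within I A X \<eta> \<psi> \<phi> C =
     Limsup at_top (\<lambda>T::real. ereal (1 / T) *
       elog (\<Sum>\<^sub>\<infinity>w\<in>{w \<in> C. ereal (T - \<eta>) < birkhoff_sup I A X \<psi> w
                            \<and> birkhoff_sup I A X \<psi> w \<le> ereal T}.
               eexp (birkhoff_sup I A X \<phi> w)))"

definition induced_pressure ::
    "nat set \<Rightarrow> (nat \<Rightarrow> nat \<Rightarrow> bool) \<Rightarrow> real
      \<Rightarrow> ((nat \<Rightarrow> nat) \<Rightarrow> real) \<Rightarrow> ((nat \<Rightarrow> nat) \<Rightarrow> real) \<Rightarrow> nat list set \<Rightarrow> ereal" where
  "induced_pressure I A \<eta> \<psi> \<phi> C = pressure_within I A (shift_space I A) \<eta> \<psi> \<phi> C"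

definition words_meeting ::
    "nat set \<Rightarrow> (nat \<Rightarrow> nat \<Rightarrow> bool) \<Rightarrow> (nat \<Rightarrow> nat) set \<Rightarrow> nat list set" where
  "words_meeting I A K = {w \<in> words I A. cylinder I A w \<inter> K \<noteq> {}}"

definition restricted_pressure ::
    "nat set \<Rightarrow> (nat \<Rightarrow> nat \<Rightarrow> bool) \<Rightarrow> real \<Rightarrow> (nat \<Rightarrow> nat) set
      \<Rightarrow> ((nat \<Rightarrow> nat) \<Rightarrow> real) \<Rightarrow> ((nat \<Rightarrow> nat) \<Rightarrow> real) \<Rightarrow> nat list set \<Rightarrow> ereal" where
  "restricted_pressure I A \<eta> K \<psi> \<phi> C = pressure_within I A K \<eta> \<psi> \<phi> (C \<inter> words_meeting I A K)"

definition exhausting_principle ::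
    "nat set \<Rightarrow> (nat \<Rightarrow> nat \<Rightarrow> bool) \<Rightarrow> real
      \<Rightarrow> ((nat \<Rightarrow> nat) \<Rightarrow> real) \<Rightarrow> ((nat \<Rightarrow> nat) \<Rightarrow> real) \<Rightarrow> nat list set \<Rightarrow> bool" where
  "exhausting_principle I A \<eta> \<psi> \<phi> C \<longleftrightarrow>
     (\<exists>K :: nat \<Rightarrow> (nat \<Rightarrow> nat) set. (\<forall>n. K n \<in> compact_invariant I A) \<and>
        (\<lambda>n. restricted_pressure I A \<eta> (K n) \<psi> \<phi> C) \<longlonglongrightarrow> induced_pressure I A \<eta> \<psi> \<phi> C)"

section \<open>Periodic words and irreducible components\<close>

definition periodic :: "nat list \<Rightarrow> (nat \<Rightarrow> nat)" where
  "periodic w = (\<lambda>i. w ! (i mod length w))"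

definition per_words :: "nat set \<Rightarrow> (nat \<Rightarrow> nat \<Rightarrow> bool) \<Rightarrow> nat \<Rightarrow> nat list set" where
  "per_words I A a = {w \<in> words I A. hd w = a \<and> periodic w \<in> shift_space I A}"

definition leads_to :: "nat set \<Rightarrow> (nat \<Rightarrow> nat \<Rightarrow> bool) \<Rightarrow> nat \<Rightarrow> nat \<Rightarrow> bool" where
  "leads_to I A a b \<longleftrightarrow> (\<exists>t\<in>words I A. a # t @ [b] \<in> words I A)"

definition component :: "nat set \<Rightarrow> (nat \<Rightarrow> nat \<Rightarrow> bool) \<Rightarrow> nat \<Rightarrow> (nat \<Rightarrow> nat) set" where
  "component I A a = {x \<in> shift_space I A. leads_to I A a (x 0) \<and> (\<forall>i. leads_to I A (x i) a)}"

definition irreducible_shift :: "nat set \<Rightarrow> (nat \<Rightarrow> nat \<Rightarrow> bool) \<Rightarrow> bool" where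
  "irreducible_shift I A \<longleftrightarrow> (\<forall>i\<in>I. \<forall>j\<in>I. leads_to I A i j)"

end

theory Submission
  imports Defs
begin

text \<open>
  Write \<open>S\<^sub>w f\<close> for the supremum of the Birkhoff sum of \<open>f\<close> over the cylinder of \<open>w\<close>. By bounded
  distortion, \<open>w \<mapsto> S\<^sub>w \<phi>\<close> and \<open>w \<mapsto> S\<^sub>w \<psi>\<close> are additive under concatenation up to a constant, and the
  induced pressure is the critical exponent of the tails, as \<open>S\<^sub>w \<psi>\<close> grows, of the series with terms
  \<open>exp (S\<^sub>w \<phi> - s * S\<^sub>w \<psi>)\<close>. Operations that change words injectively and the sums \<open>S\<^sub>w\<close> boundedly
  therefore preserve upper bounds on the pressure.

  A compact invariant set \<open>K\<close> uses finitely many letters, and \<open>\<psi>\<close> is bounded below on it. A word of \<open>K\<close>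
  in the component of \<open>a\<close> is closed up to a loop at \<open>a\<close> by one of finitely many pairs of connecting
  words. For all words of \<open>K\<close>, one removes the letters one at a time: a word containing \<open>a\<close> consists of
  a loop at \<open>a\<close> from the first to the last occurrence of \<open>a\<close> and two words without \<open>a\<close>.

  Conversely, let \<open>s\<close> be below the pressure of the loops at \<open>a\<close>. Some window of \<open>\<psi>\<close>-values contains a
  finite set of loops of large total weight. These need not form a code, but after appending a fixed
  loop \<open>u\<close> whose \<open>\<psi>\<close>-sum exceeds the window width, a proper extension within the resulting set is longer
  by less than \<open>|u|\<close>; so the words of a fixed length modulo \<open>|u|\<close> form a prefix-free set. Its
  \<open>n\<close>-fold products are then distinct loops over a finite alphabet with total weight at least a constant
  times \<open>2\<^sup>n\<close>, so the full subshift over that alphabet has pressure at least \<open>s\<close>.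
\<close>

section \<open>The induced pressure as a critical exponent\<close>

lemma summable_on_dominated_inj:
  fixes p :: "'a \<Rightarrow> real" and q :: "'b \<Rightarrow> real"
  assumes "inj_on f S" "f ` S \<subseteq> S'" "q summable_on S'"
    and "\<And>x. x \<in> S \<Longrightarrow> 0 \<le> p x" "\<And>x. x \<in> S \<Longrightarrow> p x \<le> D * q (f x)"
  shows "p summable_on S"
proof -
  have "q summable_on f ` S"
    using assms(2,3) summable_on_subset_banach by blast
  then have "(\<lambda>x. q (f x)) summable_on S"
    using assms(1) by (simp add: summable_on_reindex o_def)
  then have "(\<lambda>x. D * q (f x)) summable_on S"
    by (rule summable_on_cmult_right)
  then show ?thesis
    by (rule summable_on_comparison_test) (use assms(4,5) in auto)
qed

lemma summable_on_finite_cover: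
  fixes p :: "'a \<Rightarrow> 'c :: banach"
  assumes "finite N" "\<And>i. i \<in> N \<Longrightarrow> p summable_on B i" "S \<subseteq> (\<Union>i\<in>N. B i)"
  shows "p summable_on S"
proof -
  have "p summable_on (\<Union>i\<in>N. B i)" using assms(1,2)
  proof (induction N)
    case (insert i N)
    have "p summable_on (B i \<union> ((\<Union>i\<in>N. B i) - B i))"
      by (intro summable_on_Un_disjoint)
        (use insert in \<open>auto intro: summable_on_subset_banach\<close>)
    then show ?case by (simp add: Un_Diff_cancel)
  qed simp
  then show ?thesis using assms(3) summable_on_subset_banach by blast
qed

text \<open>The induced pressure with abstract real data: \<open>b\<close> stands for the sums of
  \<psi> and \<open>c\<close> for those of \<phi>. The same statements then serve suprema over the
  whole shift and over an invariant subset.\<close>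

definition exponent :: "real \<Rightarrow> ('a \<Rightarrow> real) \<Rightarrow> ('a \<Rightarrow> real) \<Rightarrow> 'a set \<Rightarrow> ereal" where
  "exponent \<eta> b c C = Limsup at_top (\<lambda>T::real. ereal (1 / T) *
     elog (\<Sum>\<^sub>\<infinity>w\<in>{w \<in> C. T - \<eta> < b w \<and> b w \<le> T}. ennreal (exp (c w))))"

definition weight :: "('a \<Rightarrow> real) \<Rightarrow> ('a \<Rightarrow> real) \<Rightarrow> real \<Rightarrow> 'a \<Rightarrow> real" where
  "weight b c s w = exp (c w - s * b w)"

lemma weight_pos [simp]: "weight b c s w > 0" "weight b c s w \<ge> 0"
  by (simp_all add: weight_def)

text \<open>Trades the normalised logarithm for a bound on the partition sum itself; the values 0
  and \<infinity> of \<open>z\<close> agree with the conventions of \<open>elog\<close>.\<close>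

lemma elog_scaled_le_iff:
  assumes "T > 0"
  shows "ereal (1 / T) * elog z \<le> ereal s \<longleftrightarrow> z \<le> ennreal (exp (s * T))"
proof (cases z)
  case (real r)
  show ?thesis
  proof (cases "r = 0")
    case False
    with real have r: "r > 0" by simp
    have "ln r / T \<le> s \<longleftrightarrow> ln r \<le> s * T" using assms by (simp add: field_simps)
    also have "\<dots> \<longleftrightarrow> r \<le> exp (s * T)" using r by (metis exp_le_cancel_iff exp_ln)
    finally show ?thesis using real r by (simp add: elog_def)
  qed (use real assms in \<open>simp add: elog_def\<close>)
qed (use assms in \<open>simp add: elog_def top_unique\<close>)

lemma infsum_ennreal_le:
  assumes "\<And>F. finite F \<Longrightarrow> F \<subseteq> A \<Longrightarrow> (\<Sum>x\<in>F. f x) \<le> M" "\<And>x. 0 \<le> f x"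
  shows "(\<Sum>\<^sub>\<infinity>x\<in>A. ennreal (f x)) \<le> ennreal M"
  unfolding nonneg_infsum_complete[OF zero_le]
  by (rule SUP_least) (use assms in \<open>auto simp: sum_ennreal intro!: ennreal_leI\<close>)

lemma infsum_ennreal_ge:
  assumes "finite F" "F \<subseteq> A" "(\<Sum>\<^sub>\<infinity>x\<in>A. ennreal (f x)) \<le> ennreal M" "M \<ge> 0" "\<And>x. 0 \<le> f x"
  shows "(\<Sum>x\<in>F. f x) \<le> M"
proof -
  have "ennreal (\<Sum>x\<in>F. f x) \<le> (\<Sum>\<^sub>\<infinity>x\<in>A. ennreal (f x))"
    unfolding nonneg_infsum_complete[OF zero_le]
    by (rule SUP_upper2[of F]) (use assms in \<open>auto simp: sum_ennreal\<close>)
  with assms show ?thesis by (meson ennreal_le_iff order_trans)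
qed

text \<open>Inside a window \<open>s * b w\<close> differs from \<open>s * T\<close> by at most
  \<open>\<bar>s\<bar> * \<eta>\<close>; the absolute value is there because \<open>s\<close> may be
  negative.\<close>

lemma weight_window:
  assumes "T - \<eta> < b w" "b w \<le> T"
  shows "exp (c w) \<le> exp (s * T + \<bar>s\<bar> * \<eta>) * weight b c s w"
    and "weight b c s w \<le> exp (\<bar>s\<bar> * \<eta> - s * T) * exp (c w)"
proof -
  have "\<bar>s * (T - b w)\<bar> \<le> \<bar>s\<bar> * \<eta>"
    unfolding abs_mult by (rule mult_left_mono) (use assms in auto)
  then have "s * b w \<le> s * T + \<bar>s\<bar> * \<eta>" "s * T \<le> s * b w + \<bar>s\<bar> * \<eta>"
    by (auto simp: algebra_simps abs_le_iff)
  then show "exp (c w) \<le> exp (s * T + \<bar>s\<bar> * \<eta>) * weight b c s w"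
    and "weight b c s w \<le> exp (\<bar>s\<bar> * \<eta> - s * T) * exp (c w)"
    by (auto simp: weight_def exp_add[symmetric])
qed

text \<open>Bounded window weights bound the partition sum by a constant times
  \<open>exp (s * T)\<close>, and the constant disappears on division by \<open>T\<close>. Read
  contrapositively, a pressure above \<open>s\<close> yields windows of arbitrarily large
  weight.\<close>

lemma exponent_le_if_windows_bounded:
  assumes bound: "\<And>T F. T \<ge> T0 \<Longrightarrow> finite F \<Longrightarrow> F \<subseteq> {w \<in> C. T - \<eta> < b w \<and> b w \<le> T}
      \<Longrightarrow> (\<Sum>w\<in>F. weight b c s w) \<le> M"
  shows "exponent \<eta> b c C \<le> ereal s"
proof (rule ereal_le_epsilon2)
  fix e :: real assume e: "e > 0"
  have M: "M \<ge> 0" using bound[of T0 "{}"] by simp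
  define R where "R = exp (\<bar>s\<bar> * \<eta>) * M"
  have "filterlim (\<lambda>T. exp (e * T)) at_top at_top"
    by (intro filterlim_compose[OF exp_at_top]
        filterlim_tendsto_pos_mult_at_top[OF tendsto_const e filterlim_ident])
  then have "\<forall>\<^sub>F T in at_top. R \<le> exp (e * T)"
    by (simp add: filterlim_at_top)
  then have "\<forall>\<^sub>F T in at_top. ereal (1 / T) *
     elog (\<Sum>\<^sub>\<infinity>w\<in>{w \<in> C. T - \<eta> < b w \<and> b w \<le> T}. ennreal (exp (c w))) \<le> ereal (s + e)"
    using eventually_ge_at_top[of T0] eventually_gt_at_top[of 0]
  proof eventually_elim
    case (elim T)
    have "(\<Sum>\<^sub>\<infinity>w\<in>{w \<in> C. T - \<eta> < b w \<and> b w \<le> T}. ennreal (exp (c w)))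
        \<le> ennreal (exp ((s + e) * T))"
    proof (rule infsum_ennreal_le)
      fix F assume F: "finite F" "F \<subseteq> {w \<in> C. T - \<eta> < b w \<and> b w \<le> T}"
      have "(\<Sum>w\<in>F. exp (c w)) \<le> (\<Sum>w\<in>F. exp (s * T + \<bar>s\<bar> * \<eta>) * weight b c s w)"
        by (rule sum_mono) (use F in \<open>auto intro!: weight_window\<close>)
      also have "\<dots> \<le> exp (s * T + \<bar>s\<bar> * \<eta>) * M"
        unfolding sum_distrib_left[symmetric] using bound[OF elim(2) F] by simp
      also have "\<dots> = exp (s * T) * R" by (simp add: R_def exp_add)
      also have "\<dots> \<le> exp (s * T) * exp (e * T)" using elim by simp
      also have "\<dots> = exp ((s + e) * T)" by (simp add: exp_add[symmetric] algebra_simps)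
      finally show "(\<Sum>w\<in>F. exp (c w)) \<le> exp ((s + e) * T)" .
    qed simp
    then show ?case using elim by (simp add: elog_scaled_le_iff)
  qed
  then show "exponent \<eta> b c C \<le> ereal s + ereal e"
    unfolding exponent_def by (simp add: Limsup_bounded)
qed

lemma exponent_le_if_summable:
  assumes "weight b c s summable_on {w \<in> C. T0 \<le> b w}"
  shows "exponent \<eta> b c C \<le> ereal s"
proof (rule exponent_le_if_windows_bounded)
  fix T F assume "T \<ge> T0 + \<eta>" "finite F" "F \<subseteq> {w \<in> C. T - \<eta> < b w \<and> b w \<le> T}"
  then show "(\<Sum>w\<in>F. weight b c s w) \<le> infsum (weight b c s) {w \<in> C. T0 \<le> b w}"
    by (intro finite_sum_le_infsum assms) auto
qed

text \<open>For a real \<open>r\<close> strictly between the exponent and \<open>s\<close>, the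
  window at \<open>T\<close> has weight at most a constant times \<open>exp (- (s - r) * T)\<close>.
  Consecutive windows of width \<eta> tile the tail, so a geometric series dominates.\<close>

lemma summable_if_exponent_less:
  assumes "\<eta> > 0" "exponent \<eta> b c C < ereal s"
  obtains T0 where "weight b c s summable_on {w \<in> C. T0 \<le> b w}"
proof -
  obtain r where r: "exponent \<eta> b c C < ereal r" "r < s"
    using ereal_dense2[OF assms(2)] by auto
  have "\<forall>\<^sub>F T in at_top. ereal (1 / T) *
     elog (\<Sum>\<^sub>\<infinity>w\<in>{w \<in> C. T - \<eta> < b w \<and> b w \<le> T}. ennreal (exp (c w))) < ereal r"
    using r(1) unfolding exponent_def by (rule Limsup_lessD)
  then have "\<forall>\<^sub>F T in at_top. (\<Sum>\<^sub>\<infinity>w\<in>{w \<in> C. T - \<eta> < b w \<and> b w \<le> T}. ennreal (exp (c w)))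
      \<le> ennreal (exp (r * T))"
    using eventually_gt_at_top[of 0]
    by eventually_elim (meson elog_scaled_le_iff less_imp_le)
  then obtain T0 where T0: "\<And>T. T \<ge> T0 \<Longrightarrow>
      (\<Sum>\<^sub>\<infinity>w\<in>{w \<in> C. T - \<eta> < b w \<and> b w \<le> T}. ennreal (exp (c w))) \<le> ennreal (exp (r * T))"
    by (auto simp: eventually_at_top_linorder)
  \<comment> \<open>\<open>q k\<close> bounds the weight of the \<open>k\<close>-th window;
    \<open>k w\<close> indexes the window containing \<open>b w\<close>, and the ceiling fits
    windows open on the left and closed on the right.\<close>
  define q where "q k = exp (\<bar>s\<bar> * \<eta> - (s - r) * (T0 + real k * \<eta>))" for k :: nat
  define k where "k w = nat \<lceil>(b w - T0) / \<eta>\<rceil>" for w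
  have "q = (\<lambda>k. exp (\<bar>s\<bar> * \<eta> - (s - r) * T0) * exp (- (s - r) * \<eta>) ^ k)"
    by (auto simp: q_def exp_of_nat_mult[symmetric] exp_add[symmetric] algebra_simps)
  have q_nonneg: "q n \<ge> 0" for n by (simp add: q_def)
  have "exp (- (s - r) * \<eta>) < 1" using r assms by (simp add: mult_neg_pos)
  with \<open>q = _\<close> have "summable q"
    by (simp add: summable_mult summable_geometric)
  have "(\<Sum>w\<in>F. weight b c s w) \<le> suminf q"
    if F: "finite F" "F \<subseteq> {w \<in> C. T0 \<le> b w}" for F
  proof -
    have step: "(\<Sum>w\<in>{w \<in> F. k w = n}. weight b c s w) \<le> q n" for n
    proof -
      define T where "T = T0 + real n * \<eta>"
      have win: "{w \<in> F. k w = n} \<subseteq> {w \<in> C. T - \<eta> < b w \<and> b w \<le> T}"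
      proof
        fix w assume w: "w \<in> {w \<in> F. k w = n}"
        with F have "T0 \<le> b w" "w \<in> C" by auto
        then have "real n = of_int \<lceil>(b w - T0) / \<eta>\<rceil>"
          using w assms by (auto simp: k_def)
        then have "real n - 1 < (b w - T0) / \<eta>" "(b w - T0) / \<eta> \<le> real n"
          by linarith+
        with assms show "w \<in> {w \<in> C. T - \<eta> < b w \<and> b w \<le> T}" using \<open>w \<in> C\<close>
          by (auto simp: T_def field_simps)
      qed
      have "(\<Sum>w\<in>{w \<in> F. k w = n}. weight b c s w)
          \<le> (\<Sum>w\<in>{w \<in> F. k w = n}. exp (\<bar>s\<bar> * \<eta> - s * T) * exp (c w))"
        by (rule sum_mono) (use win in \<open>auto intro!: weight_window\<close>)
      also have "\<dots> \<le> exp (\<bar>s\<bar> * \<eta> - s * T) * exp (r * T)"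
        unfolding sum_distrib_left[symmetric]
        by (intro mult_left_mono infsum_ennreal_ge[OF _ win T0])
          (use F assms in \<open>auto simp: T_def\<close>)
      also have "\<dots> = q n" by (simp add: q_def T_def exp_add[symmetric] algebra_simps)
      finally show ?thesis .
    qed
    have "(\<Sum>w\<in>F. weight b c s w) = (\<Sum>n\<in>k ` F. \<Sum>w\<in>{w \<in> F. k w = n}. weight b c s w)"
      by (rule sum.image_gen[OF F(1)])
    also have "\<dots> \<le> (\<Sum>n\<in>k ` F. q n)" by (rule sum_mono) (rule step)
    also have "\<dots> \<le> suminf q"
      by (rule sum_le_suminf) (use F \<open>summable q\<close> q_nonneg in auto)
    finally show ?thesis .
  qed
  then have "weight b c s summable_on {w \<in> C. T0 \<le> b w}"
    by (intro nonneg_bdd_above_summable_on bdd_aboveI[of _ "suminf q"]) auto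
  with that show ?thesis .
qed

text \<open>Moving both sums by at most \<open>D\<close> changes a weight by a factor of at most
  \<open>exp (D + \<bar>s\<bar> * D)\<close>. The threshold rises by \<open>D\<close> so that the
  images still lie above \<open>T0\<close>.\<close>

lemma summable_weight_transfer:
  assumes "weight b' c' s summable_on {w \<in> C'. T0 \<le> b' w}"
    and "inj_on f C" "f ` C \<subseteq> C'"
    and "\<And>w. w \<in> C \<Longrightarrow> \<bar>b' (f w) - b w\<bar> \<le> D" "\<And>w. w \<in> C \<Longrightarrow> \<bar>c' (f w) - c w\<bar> \<le> D"
  shows "weight b c s summable_on {w \<in> C. T0 + D \<le> b w}"
proof (rule summable_on_dominated_inj[OF _ _ assms(1)])
  show "inj_on f {w \<in> C. T0 + D \<le> b w}" using assms(2) by (auto simp: inj_on_def)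
  show "f ` {w \<in> C. T0 + D \<le> b w} \<subseteq> {w \<in> C'. T0 \<le> b' w}"
    using assms(3,4) by (force simp: abs_le_iff)
  fix w assume "w \<in> {w \<in> C. T0 + D \<le> b w}"
  then have w: "w \<in> C" by simp
  have "\<bar>s * (b' (f w) - b w)\<bar> \<le> \<bar>s\<bar> * D"
    unfolding abs_mult using assms(4)[OF w] by (simp add: mult_left_mono)
  then have "c w - s * b w \<le> (D + \<bar>s\<bar> * D) + (c' (f w) - s * b' (f w))"
    using assms(5)[OF w] by (auto simp: algebra_simps abs_le_iff)
  then show "weight b c s w \<le> exp (D + \<bar>s\<bar> * D) * weight b' c' s (f w)"
    by (simp add: weight_def exp_add[symmetric])
qed simp

section \<open>Bounded distortion\<close>

lemma funpow_shift: "(shift ^^ k) x = (\<lambda>i. x (i + k))"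
  by (induction k) (auto simp: shift_def)

definition bsum :: "((nat \<Rightarrow> nat) \<Rightarrow> real) \<Rightarrow> nat \<Rightarrow> (nat \<Rightarrow> nat) \<Rightarrow> real" where
  "bsum f n x = (\<Sum>k<n. f ((shift ^^ k) x))"

lemma bsum_add: "bsum f (m + n) x = bsum f m x + bsum f n ((shift ^^ m) x)"
proof (induction n)
  case (Suc n)
  have "(shift ^^ (m + n)) x = (shift ^^ n) ((shift ^^ m) x)"
    by (simp add: funpow_shift ac_simps)
  with Suc show ?case by (simp add: bsum_def)
qed (simp add: bsum_def)

lemma funpow_shift_in_shift_space:
  "x \<in> shift_space I A \<Longrightarrow> (shift ^^ k) x \<in> shift_space I A"
  by (simp add: shift_space_def funpow_shift)

lemma cylinder_subset: "cylinder I A w \<subseteq> shift_space I A"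
  by (auto simp: cylinder_def)

lemma in_cylinder_append_iff:
  "x \<in> cylinder I A (u @ v) \<longleftrightarrow> x \<in> cylinder I A u \<and> (shift ^^ length u) x \<in> cylinder I A v"
proof
  assume x: "x \<in> cylinder I A (u @ v)"
  then have eq: "x i = (u @ v) ! i" if "i < length u + length v" for i
    using that by (simp add: cylinder_def)
  have "x (i + length u) = v ! i" if "i < length v" for i
    using eq[of "i + length u"] that by (simp add: nth_append)
  moreover have "x i = u ! i" if "i < length u" for i
    using eq[of i] that by (simp add: nth_append)
  ultimately have "\<forall>i<length v. x (i + length u) = v ! i" "\<forall>i<length u. x i = u ! i"
    by blast+
  with x show "x \<in> cylinder I A u \<and> (shift ^^ length u) x \<in> cylinder I A v"
    using funpow_shift_in_shift_space[of x I A "length u"] by (simp add: cylinder_def funpow_shift)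
next
  assume "x \<in> cylinder I A u \<and> (shift ^^ length u) x \<in> cylinder I A v"
  then have x: "x \<in> shift_space I A" "\<forall>i<length u. x i = u ! i"
    "\<forall>i<length v. x (i + length u) = v ! i"
    by (simp_all add: cylinder_def funpow_shift)
  have "x i = (u @ v) ! i" if "i < length (u @ v)" for i
    using x(2) x(3)[rule_format, of "i - length u"] that by (auto simp: nth_append)
  with x(1) show "x \<in> cylinder I A (u @ v)" by (simp add: cylinder_def)
qed

lemma cylinder_eq_take: "x \<in> cylinder I A w \<longleftrightarrow> x \<in> shift_space I A \<and> map x [0..<length w] = w"
proof -
  have "map x [0..<length w] = w \<longleftrightarrow> (\<forall>i<length w. x i = w ! i)"
    by (subst list_eq_iff_nth_eq) simp
  then show ?thesis by (simp add: cylinder_def)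
qed

lemma map_upt_in_words:
  assumes "x \<in> shift_space I A" "i < n"
  shows "map x [i..<n] \<in> words I A"
  using assms by (auto simp: words_def shift_space_def successively_conv_nth)

lemma cylinder_nonempty_word:
  assumes "x \<in> cylinder I A w" "w \<noteq> []"
  shows "w \<in> words I A"
proof -
  have "map x [0..<length w] = w" using assms(1) unfolding cylinder_eq_take by (rule conjunct2)
  moreover have "map x [0..<length w] \<in> words I A"
    using assms cylinder_subset by (intro map_upt_in_words) auto
  ultimately show ?thesis by (rule subst)
qed

text \<open>After \<open>k\<close> shifts two points of the cylinder of \<open>w\<close> still share
  \<open>length w - k\<close> letters, so the summands differ by terms of a geometric series, whose
  total is bounded independently of \<open>w\<close>.\<close>

lemma birkhoff_distortion:
  assumes "holder_continuous I A f"
  obtains C where "C \<ge> 0"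
    "\<And>w x y. x \<in> cylinder I A w \<Longrightarrow> y \<in> cylinder I A w
      \<Longrightarrow> \<bar>bsum f (length w) x - bsum f (length w) y\<bar> \<le> C"
proof -
  obtain \<alpha> V where \<alpha>: "\<alpha> > 0" and V: "V \<ge> 0"
    and holder: "\<And>x y. x \<in> shift_space I A \<Longrightarrow> y \<in> shift_space I A \<Longrightarrow>
      common_length x y \<ge> 1 \<Longrightarrow> \<bar>f x - f y\<bar> \<le> V * d_shift \<alpha> x y"
    using assms unfolding holder_continuous_def by blast
  define r where "r = exp (- \<alpha>)"
  have r: "0 < r" "r < 1" using \<alpha> by (auto simp: r_def)
  have "\<bar>bsum f (length w) x - bsum f (length w) y\<bar> \<le> V * (1 / (1 - r))"
    if xy: "x \<in> cylinder I A w" "y \<in> cylinder I A w" for w x y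
  proof -
    let ?n = "length w"
    have summand: "\<bar>f ((shift ^^ k) x) - f ((shift ^^ k) y)\<bar> \<le> V * r ^ (?n - k)" if k: "k < ?n" for k
    proof -
      have len: "enat (?n - k) \<le> common_length ((shift ^^ k) x) ((shift ^^ k) y)"
        using xy by (simp add: common_length_ge_iff funpow_shift cylinder_def)
      moreover have "1 \<le> enat (?n - k)" using k by (simp add: one_enat_def)
      ultimately have "1 \<le> common_length ((shift ^^ k) x) ((shift ^^ k) y)" by (rule order_trans[rotated])
      with xy have "\<bar>f ((shift ^^ k) x) - f ((shift ^^ k) y)\<bar>
          \<le> V * d_shift \<alpha> ((shift ^^ k) x) ((shift ^^ k) y)"
        by (intro holder funpow_shift_in_shift_space) (auto simp: cylinder_def)
      also have "d_shift \<alpha> ((shift ^^ k) x) ((shift ^^ k) y) \<le> exp (- \<alpha> * real (?n - k))"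
        using len \<alpha> by (auto simp: d_shift_def split: enat.split)
      also have "\<dots> = r ^ (?n - k)"
        by (simp add: r_def exp_of_nat_mult[symmetric] mult.commute)
      finally show ?thesis using V by (simp add: mult_left_mono)
    qed
    have "\<bar>bsum f ?n x - bsum f ?n y\<bar> \<le> (\<Sum>k<?n. \<bar>f ((shift ^^ k) x) - f ((shift ^^ k) y)\<bar>)"
      unfolding bsum_def sum_subtractf[symmetric] by (rule sum_abs)
    also have "\<dots> \<le> (\<Sum>k<?n. V * r ^ (?n - k))" by (rule sum_mono) (use summand in auto)
    also have "\<dots> = V * (\<Sum>k<?n. r ^ (?n - k))" by (simp add: sum_distrib_left)
    also have "(\<Sum>k<?n. r ^ (?n - k)) = (\<Sum>k<?n. r ^ Suc k)"
      by (subst sum.nat_diff_reindex[symmetric]) (auto intro!: sum.cong simp: Suc_diff_Suc)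
    also have "\<dots> \<le> (\<Sum>k<?n. r ^ k)" by (rule sum_mono) (use r in \<open>auto simp: mult_left_le_one_le\<close>)
    also have "\<dots> \<le> (\<Sum>k. r ^ k)" by (rule sum_le_suminf) (use r in \<open>auto simp: summable_geometric\<close>)
    also have "\<dots> = 1 / (1 - r)" using r by (simp add: suminf_geometric)
    finally show ?thesis using V by (simp add: mult_left_mono)
  qed
  moreover have "V * (1 / (1 - r)) \<ge> 0" using V r by simp
  ultimately show ?thesis using that by blast
qed

text \<open>Continuity in combinatorial form, prepared for the compactness argument that bounds
  \<psi> from below.\<close>

lemma holder_locally_positive:
  assumes "holder_continuous I A f" "x \<in> shift_space I A" "f x > 0"
  obtains k where "\<And>y. y \<in> shift_space I A \<Longrightarrow> (\<forall>i<k. x i = y i) \<Longrightarrow> f y > f x / 2"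
proof -
  obtain \<alpha> V where \<alpha>: "\<alpha> > 0" and V: "V \<ge> 0"
    and holder: "\<And>x y. x \<in> shift_space I A \<Longrightarrow> y \<in> shift_space I A \<Longrightarrow>
      common_length x y \<ge> 1 \<Longrightarrow> \<bar>f x - f y\<bar> \<le> V * d_shift \<alpha> x y"
    using assms(1) unfolding holder_continuous_def by blast
  have "(\<lambda>n. V * exp (- \<alpha>) ^ n) \<longlonglongrightarrow> V * 0"
    by (intro tendsto_intros LIMSEQ_power_zero) (use \<alpha> in auto)
  then have "\<forall>\<^sub>F n in sequentially. V * exp (- \<alpha>) ^ n < f x / 2"
    using assms(3) by (intro order_tendstoD) auto
  then obtain N where "\<And>n. n \<ge> N \<Longrightarrow> V * exp (- \<alpha>) ^ n < f x / 2"
    by (auto simp: eventually_sequentially)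
  \<comment> \<open>The exponent \<open>Suc n\<close> guarantees one common letter, without which
    the Hoelder inequality says nothing.\<close>
  then obtain n where n: "V * exp (- \<alpha>) ^ Suc n < f x / 2"
    using le_SucI by blast
  show ?thesis
  proof (rule that)
    fix y assume y: "y \<in> shift_space I A" "\<forall>i<Suc n. x i = y i"
    then have len: "enat (Suc n) \<le> common_length x y" by (simp add: common_length_ge_iff)
    moreover have "1 \<le> enat (Suc n)" by (simp add: one_enat_def)
    ultimately have "\<bar>f x - f y\<bar> \<le> V * d_shift \<alpha> x y"
      using holder assms(2) y(1) order_trans by blast
    also have "d_shift \<alpha> x y \<le> exp (- \<alpha> * real (Suc n))"
      using len \<alpha> by (auto simp: d_shift_def split: enat.split)
    also have "\<dots> = exp (- \<alpha>) ^ Suc n"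
      by (simp only: exp_of_nat_mult[symmetric] mult.commute)
    finally show "f y > f x / 2" using n V by (simp add: mult_left_mono abs_le_iff)
  qed
qed

text \<open>Records the consequences of Hoelder continuity on which the rest is built: one
  distortion constant \<open>C\<close> for both functions, and local lower bounds for
  \<psi>.\<close>

locale shift_system =
  fixes I :: "nat set" and A :: "nat \<Rightarrow> nat \<Rightarrow> bool"
    and \<phi> \<psi> :: "(nat \<Rightarrow> nat) \<Rightarrow> real" and C :: real
  assumes C_nonneg: "C \<ge> 0"
    and distortion: "f \<in> {\<phi>, \<psi>} \<Longrightarrow> x \<in> cylinder I A w \<Longrightarrow> y \<in> cylinder I A w
      \<Longrightarrow> \<bar>bsum f (length w) x - bsum f (length w) y\<bar> \<le> C"
    and \<psi>_pos: "x \<in> shift_space I A \<Longrightarrow> \<psi> x > 0"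
    and \<psi>_locally_positive: "x \<in> shift_space I A \<Longrightarrow>
      \<exists>k. \<forall>y\<in>shift_space I A. (\<forall>i<k. x i = y i) \<longrightarrow> \<psi> y > \<psi> x / 2"
begin

abbreviation \<Sigma> :: "(nat \<Rightarrow> nat) set" where "\<Sigma> \<equiv> shift_space I A"
abbreviation cyl :: "nat list \<Rightarrow> (nat \<Rightarrow> nat) set" where "cyl \<equiv> cylinder I A"

text \<open>Informative for words with nonempty cylinder; for the others the supremum is
  -\<infinity> and \<open>real_of_ereal\<close> returns 0.\<close>

definition wsum :: "((nat \<Rightarrow> nat) \<Rightarrow> real) \<Rightarrow> nat list \<Rightarrow> real" where
  "wsum f w = real_of_ereal (birkhoff_sup I A \<Sigma> f w)"

abbreviation p :: "real \<Rightarrow> nat list \<Rightarrow> real" where "p \<equiv> weight (wsum \<psi>) (wsum \<phi>)"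

text \<open>An admissible word may fail to have an infinite continuation; such words are left out
  here. The empty word belongs to \<open>lang\<close> as soon as \<Sigma> is nonempty.\<close>

definition lang :: "nat list set" where "lang = {w. cyl w \<noteq> {}}"

text \<open>By distortion, any single point of the cylinder determines the supremum up to
  \<open>C\<close>; in particular the supremum is finite.\<close>

lemma birkhoff_sup_bounds:
  assumes f: "f \<in> {\<phi>, \<psi>}" and x: "x \<in> cyl w \<inter> X"
  obtains r where "birkhoff_sup I A X f w = ereal r"
    "bsum f (length w) x \<le> r" "r \<le> bsum f (length w) x + C"
proof -
  have "birkhoff_sup I A X f w \<le> ereal (bsum f (length w) x + C)"
    unfolding birkhoff_sup_def bsum_def[symmetric]
  proof (rule SUP_least)
    fix y assume "y \<in> cyl w \<inter> X"
    then show "ereal (bsum f (length w) y) \<le> ereal (bsum f (length w) x + C)"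
      using distortion[OF f, of x w y] x by (simp add: abs_le_iff)
  qed
  moreover have "ereal (bsum f (length w) x) \<le> birkhoff_sup I A X f w"
    unfolding birkhoff_sup_def bsum_def[symmetric] by (rule SUP_upper[OF x])
  ultimately show ?thesis
    by (cases "birkhoff_sup I A X f w") (auto intro: that)
qed

lemma birkhoff_sup_empty: "cyl w \<inter> X = {} \<Longrightarrow> birkhoff_sup I A X f w = -\<infinity>"
  by (simp add: birkhoff_sup_def bot_ereal_def)

lemma wsum_bounds:
  assumes "f \<in> {\<phi>, \<psi>}" "x \<in> cyl w"
  shows "bsum f (length w) x \<le> wsum f w" "wsum f w \<le> bsum f (length w) x + C"
proof -
  have "x \<in> cyl w \<inter> \<Sigma>" using assms(2) cylinder_subset by blast
  from birkhoff_sup_bounds[OF assms(1) this] obtain r where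
    "birkhoff_sup I A \<Sigma> f w = ereal r" "bsum f (length w) x \<le> r" "r \<le> bsum f (length w) x + C" .
  then show "bsum f (length w) x \<le> wsum f w" "wsum f w \<le> bsum f (length w) x + C"
    by (simp_all add: wsum_def)
qed

lemma lang_append:
  assumes "u @ v \<in> lang"
  shows "u \<in> lang" "v \<in> lang"
  using assms by (auto simp: lang_def in_cylinder_append_iff)

text \<open>Birkhoff sums are exactly additive at one point of the cylinder of \<open>u @ v\<close>,
  and replacing each of the three suprema by its value there costs at most \<open>C\<close>.\<close>

lemma wsum_append:
  assumes f: "f \<in> {\<phi>, \<psi>}" and uv: "u @ v \<in> lang"
  shows "\<bar>wsum f (u @ v) - wsum f u - wsum f v\<bar> \<le> 3 * C"
proof -
  obtain x where x: "x \<in> cyl (u @ v)" using uv by (auto simp: lang_def)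
  then have "x \<in> cyl u" "(shift ^^ length u) x \<in> cyl v" by (simp_all add: in_cylinder_append_iff)
  from wsum_bounds[OF f this(1)] wsum_bounds[OF f this(2)] wsum_bounds[OF f x] C_nonneg
  show ?thesis by (simp add: bsum_add abs_le_iff)
qed

lemma bsum_\<psi>_nonneg: "x \<in> \<Sigma> \<Longrightarrow> bsum \<psi> n x \<ge> 0"
  unfolding bsum_def
  by (intro sum_nonneg less_imp_le \<psi>_pos funpow_shift_in_shift_space)

lemma wsum_\<psi>_nonneg:
  assumes "w \<in> lang" shows "wsum \<psi> w \<ge> 0"
proof -
  obtain x where x: "x \<in> cyl w" using assms by (auto simp: lang_def)
  then have "x \<in> \<Sigma>" using cylinder_subset by blast
  with wsum_bounds(1)[of \<psi>, OF _ x] bsum_\<psi>_nonneg[of x "length w"] show ?thesis by simp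
qed

lemma weight_append:
  assumes "u @ v \<in> lang"
  shows "p s (u @ v) \<le> exp (3 * C * (1 + \<bar>s\<bar>)) * (p s u * p s v)"
    and "p s u * p s v \<le> exp (3 * C * (1 + \<bar>s\<bar>)) * p s (u @ v)"
proof -
  have "\<bar>s * (wsum \<psi> (u @ v) - wsum \<psi> u - wsum \<psi> v)\<bar> \<le> \<bar>s\<bar> * (3 * C)"
    unfolding abs_mult by (rule mult_left_mono[OF wsum_append[OF _ assms]]) auto
  moreover have "\<bar>wsum \<phi> (u @ v) - wsum \<phi> u - wsum \<phi> v\<bar> \<le> 3 * C"
    by (rule wsum_append[OF _ assms]) simp
  ultimately show "p s (u @ v) \<le> exp (3 * C * (1 + \<bar>s\<bar>)) * (p s u * p s v)"
    "p s u * p s v \<le> exp (3 * C * (1 + \<bar>s\<bar>)) * p s (u @ v)"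
    by (auto simp: weight_def exp_add[symmetric] abs_le_iff algebra_simps)
qed

text \<open>A word whose cylinder misses \<open>X\<close> has supremum -\<infinity> and lies in no
  window, so all remaining suprema are real numbers.\<close>

lemma pressure_within_eq_exponent:
  "pressure_within I A X \<eta> \<psi> \<phi> W = exponent \<eta> (\<lambda>w. real_of_ereal (birkhoff_sup I A X \<psi> w))
     (\<lambda>w. real_of_ereal (birkhoff_sup I A X \<phi> w)) {w \<in> W. cyl w \<inter> X \<noteq> {}}"
proof -
  have real: "birkhoff_sup I A X f w = ereal (real_of_ereal (birkhoff_sup I A X f w))"
    if "cyl w \<inter> X \<noteq> {}" "f \<in> {\<phi>, \<psi>}" for f w
    using that by (metis birkhoff_sup_bounds ex_in_conv real_of_ereal.simps(1))
  have window: "{w \<in> W. ereal (T - \<eta>) < birkhoff_sup I A X \<psi> w \<and> birkhoff_sup I A X \<psi> w \<le> ereal T}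
     = {w \<in> {w \<in> W. cyl w \<inter> X \<noteq> {}}. T - \<eta> < real_of_ereal (birkhoff_sup I A X \<psi> w)
          \<and> real_of_ereal (birkhoff_sup I A X \<psi> w) \<le> T}" for T
  proof (rule Collect_cong, goal_cases)
    case (1 w)
    show ?case
    proof (cases "cyl w \<inter> X = {}")
      case True
      then show ?thesis by (simp add: birkhoff_sup_empty)
    next
      case False
      from real[OF this, of \<psi>] obtain r where "birkhoff_sup I A X \<psi> w = ereal r" by auto
      with False show ?thesis by simp
    qed
  qed
  have "eexp (birkhoff_sup I A X \<phi> w) = ennreal (exp (real_of_ereal (birkhoff_sup I A X \<phi> w)))"
    if "cyl w \<inter> X \<noteq> {}" for w
  proof -
    from real[OF that, of \<phi>] obtain r where "birkhoff_sup I A X \<phi> w = ereal r" by auto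
    then show ?thesis by (simp add: eexp_def)
  qed
  then show ?thesis
    unfolding pressure_within_def exponent_def window
    by (intro arg_cong[of _ _ "Limsup at_top"] ext arg_cong2[where f = "(*)"] refl
        arg_cong[of _ _ elog] infsum_cong) auto
qed

text \<open>Passing from \<open>X\<close> to the whole shift changes suprema by a bounded amount.
  Hence \<open>X\<close> influences summability only by selecting the words that meet it.\<close>

lemma birkhoff_sup_near_wsum:
  assumes "f \<in> {\<phi>, \<psi>}" "X \<subseteq> \<Sigma>" "cyl w \<inter> X \<noteq> {}"
  shows "\<bar>real_of_ereal (birkhoff_sup I A X f w) - wsum f w\<bar> \<le> C"
proof -
  obtain x where x: "x \<in> cyl w \<inter> X" using assms by blast
  from birkhoff_sup_bounds[OF assms(1) x] obtain r where
    "birkhoff_sup I A X f w = ereal r" "bsum f (length w) x \<le> r" "r \<le> bsum f (length w) x + C" .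
  with wsum_bounds[OF assms(1), of x w] x show ?thesis by (simp add: abs_le_iff)
qed

text \<open>With \<open>pressure_le_if_summable\<close>, the dictionary between pressures and
  convergent tails of the series with terms \<open>p s w\<close>.\<close>

lemma summable_if_pressure_less:
  assumes "\<eta> > 0" "X \<subseteq> \<Sigma>" "pressure_within I A X \<eta> \<psi> \<phi> W < ereal s"
  obtains T0 where "p s summable_on {w \<in> W. cyl w \<inter> X \<noteq> {} \<and> T0 \<le> wsum \<psi> w}"
proof -
  from summable_if_exponent_less[OF assms(1) assms(3)[unfolded pressure_within_eq_exponent]]
  obtain T0 where "weight (\<lambda>w. real_of_ereal (birkhoff_sup I A X \<psi> w))
     (\<lambda>w. real_of_ereal (birkhoff_sup I A X \<phi> w)) s summable_on
     {w \<in> {w \<in> W. cyl w \<inter> X \<noteq> {}}. T0 \<le> real_of_ereal (birkhoff_sup I A X \<psi> w)}" .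
  from summable_weight_transfer[OF this, of "\<lambda>w. w" "{w \<in> W. cyl w \<inter> X \<noteq> {}}" "wsum \<psi>" C "wsum \<phi>"]
  have "p s summable_on {w \<in> {w \<in> W. cyl w \<inter> X \<noteq> {}}. T0 + C \<le> wsum \<psi> w}"
    using birkhoff_sup_near_wsum[OF _ assms(2)] by auto
  then show ?thesis by (intro that[of "T0 + C"]) (simp add: conj_assoc)
qed

lemma pressure_le_if_summable:
  assumes "X \<subseteq> \<Sigma>" "p s summable_on {w \<in> W. cyl w \<inter> X \<noteq> {} \<and> T0 \<le> wsum \<psi> w}"
  shows "pressure_within I A X \<eta> \<psi> \<phi> W \<le> ereal s"
  unfolding pressure_within_eq_exponent
proof (rule exponent_le_if_summable, rule summable_weight_transfer)
  show "p s summable_on {w \<in> {w \<in> W. cyl w \<inter> X \<noteq> {}}. T0 \<le> wsum \<psi> w}"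
    using assms(2) by (simp add: conj_assoc)
qed (use birkhoff_sup_near_wsum[OF _ assms(1)] in \<open>auto simp: abs_minus_commute inj_on_def\<close>)

lemma induced_pressure_eq_exponent:
  "induced_pressure I A \<eta> \<psi> \<phi> W = exponent \<eta> (wsum \<psi>) (wsum \<phi>) (W \<inter> lang)"
proof -
  have "{w \<in> W. cyl w \<inter> \<Sigma> \<noteq> {}} = W \<inter> lang"
    using cylinder_subset[of I A] by (simp add: lang_def Int_absorb2 Collect_conj_eq)
  then show ?thesis
    unfolding induced_pressure_def pressure_within_eq_exponent by (simp add: wsum_def[abs_def])
qed

end

section \<open>Loops\<close>

lemma summable_on_times:
  fixes f :: "'a \<Rightarrow> real" and g :: "'b \<Rightarrow> real"
  assumes "f summable_on X" "g summable_on Y" "\<And>x. x \<in> X \<Longrightarrow> f x \<ge> 0" "\<And>y. y \<in> Y \<Longrightarrow> g y \<ge> 0"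
  shows "(\<lambda>(x, y). f x * g y) summable_on X \<times> Y"
proof (rule summable_on_SigmaI)
  show "(\<lambda>x. f x * infsum g Y) summable_on X"
    using assms(1) by (rule summable_on_cmult_left)
  show "((\<lambda>y. case (x, y) of (x, y) \<Rightarrow> f x * g y) has_sum f x * infsum g Y) Y" if "x \<in> X" for x
    using has_sum_cmult_right[OF has_sum_infsum[OF assms(2)]] by simp
qed (use assms in auto)

section \<open>Products of words and prefix-free sets\<close>

primrec word_powers :: "'a list set \<Rightarrow> nat \<Rightarrow> 'a list set" where
  "word_powers G 0 = {[]}"
| "word_powers G (Suc n) = (\<lambda>(g, w). g @ w) ` (G \<times> word_powers G n)"

lemma finite_word_powers: "finite G \<Longrightarrow> finite (word_powers G n)"
  by (induction n) auto

definition prefix_free :: "'a list set \<Rightarrow> bool" where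
  "prefix_free G \<longleftrightarrow> (\<forall>g\<in>G. \<forall>z. g @ z \<in> G \<longrightarrow> z = [])"

lemma prefix_free_append_inj:
  assumes "prefix_free G" "g \<in> G" "h \<in> G" "g @ v = h @ w"
  shows "g = h \<and> v = w"
proof -
  consider z where "g = h @ z" | z where "h = g @ z"
    using assms(4) by (metis append_eq_append_conv2)
  then show ?thesis using assms by cases (auto simp: prefix_free_def)
qed

text \<open>All transitions of the periodic sequence lie inside \<open>w\<close> except the one from
  its last to its first letter. Being a loop thus becomes a finite condition.\<close>

lemma periodic_in_shift_space_iff:
  assumes w: "w \<in> words I A"
  shows "periodic w \<in> shift_space I A \<longleftrightarrow> A (last w) (hd w)"
proof
  have ne: "w \<noteq> []" using w by (simp add: words_def)
  {
    assume "periodic w \<in> shift_space I A"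
    then have "A (periodic w (length w - 1)) (periodic w (Suc (length w - 1)))"
      by (simp add: shift_space_def)
    then show "A (last w) (hd w)" using ne by (simp add: periodic_def last_conv_nth hd_conv_nth)
  next
    assume wrap: "A (last w) (hd w)"
    have "A (w ! (i mod length w)) (w ! (Suc i mod length w))" for i
    proof (cases "Suc (i mod length w) = length w")
      case True
      then have "i mod length w = length w - 1" "Suc i mod length w = 0" by (auto simp: mod_Suc)
      then show ?thesis using wrap ne by (simp add: last_conv_nth hd_conv_nth)
    next
      case False
      then have "Suc (i mod length w) < length w" using ne by (simp add: Suc_lessI)
      then show ?thesis using w False by (auto simp: mod_Suc words_def successively_conv_nth)
    qed
    moreover have "w ! (i mod length w) \<in> I" for i
      using w ne by (auto simp: words_def)
    ultimately show "periodic w \<in> shift_space I A" by (simp add: shift_space_def periodic_def)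
  }
qed

lemma per_words_iff:
  "w \<in> per_words I A a \<longleftrightarrow> w \<in> words I A \<and> hd w = a \<and> A (last w) a"
  unfolding per_words_def using periodic_in_shift_space_iff by blast

lemma periodic_in_cylinder:
  assumes "w \<in> per_words I A a"
  shows "periodic w \<in> cylinder I A w"
  using assms by (auto simp: per_words_def cylinder_def periodic_def)

lemma words_append_iff:
  "u \<noteq> [] \<Longrightarrow> v \<noteq> [] \<Longrightarrow> u @ v \<in> words I A \<longleftrightarrow> u \<in> words I A \<and> v \<in> words I A \<and> A (last u) (hd v)"
  by (auto simp: words_def successively_append_iff)

lemma per_words_append:
  assumes "u \<in> per_words I A a" "v \<in> per_words I A a"
  shows "u @ v \<in> per_words I A a"
  using assms words_append_iff[of u v I A] by (auto simp: per_words_iff words_def)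

lemma word_powers_per_words:
  assumes "G \<subseteq> per_words I A a"
  shows "word_powers G n \<subseteq> insert [] (per_words I A a)"
proof (induction n)
  case (Suc n)
  then show ?case using assms by (force intro: per_words_append)
qed simp

section \<open>Lower bounds: products of loops over a finite alphabet\<close>

context shift_system
begin

lemma per_words_subset_lang: "per_words I A a \<subseteq> lang"
  using periodic_in_cylinder by (fastforce simp: lang_def)

text \<open>The lower bound on the weight of \<open>G\<close> pays for the loss in
  \<open>weight_append\<close> and still doubles the total with each factor. Prefix-freeness keeps
  different products from coinciding as words. In the same way the surplus \<open>3 * C\<close> in
  the \<psi>-sums pays for concatenation and leaves \<open>\<delta>\<close> per factor.\<close>

lemma word_powers_weight_growth:
  assumes "finite G" "G \<subseteq> per_words I A a" "\<delta> \<ge> 0"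
    and prefix_free: "prefix_free G"
    and long: "\<forall>g\<in>G. \<delta> + 3 * C \<le> wsum \<psi> g"
    and heavy: "2 * exp (3 * C * (1 + \<bar>s\<bar>)) \<le> (\<Sum>g\<in>G. p s g)"
  shows "2 ^ n * p s [] \<le> (\<Sum>w\<in>word_powers G n. p s w)"
    and "w \<in> word_powers G n \<Longrightarrow> n * \<delta> \<le> wsum \<psi> w"
proof -
  let ?D = "exp (3 * C * (1 + \<bar>s\<bar>))"
  have "G \<noteq> {}"
  proof
    assume "G = {}"
    with heavy have "?D \<le> 0" by simp
    then show False by (simp add: not_le[symmetric])
  qed
  then have nil: "[] \<in> lang"
    using assms(2) per_words_subset_lang lang_append(1)[of "[]"] by fastforce
  have powers: "word_powers G n \<subseteq> lang" for n
    using word_powers_per_words[OF assms(2)] per_words_subset_lang nil by blast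
  have gw: "g @ w \<in> lang" if "g \<in> G" "w \<in> word_powers G n" for g w n
    using powers[of "Suc n"] that by force
  show "2 ^ n * p s [] \<le> (\<Sum>w\<in>word_powers G n. p s w)"
  proof (induction n)
    case (Suc n)
    have "2 ^ Suc n * p s [] \<le> 2 * (\<Sum>w\<in>word_powers G n. p s w)"
      using Suc by simp
    also have "\<dots> = (2 * ?D) * (\<Sum>w\<in>word_powers G n. p s w) / ?D" by simp
    also have "\<dots> \<le> (\<Sum>g\<in>G. p s g) * (\<Sum>w\<in>word_powers G n. p s w) / ?D"
      by (intro divide_right_mono mult_right_mono heavy sum_nonneg) auto
    also have "\<dots> = (\<Sum>(g, w)\<in>G \<times> word_powers G n. p s g * p s w / ?D)"
      by (simp add: sum_product sum.cartesian_product sum_divide_distrib case_prod_unfold)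
    also have "\<dots> \<le> (\<Sum>(g, w)\<in>G \<times> word_powers G n. p s (g @ w))"
    proof (rule sum_mono, clarify)
      fix g w assume "g \<in> G" "w \<in> word_powers G n"
      with weight_append(2)[OF gw] show "p s g * p s w / ?D \<le> p s (g @ w)"
        by (simp add: divide_le_eq mult.commute)
    qed
    also have "\<dots> = (\<Sum>w\<in>word_powers G (Suc n). p s w)"
    proof -
      have cancel: "g = h \<and> v = w" if "g \<in> G" "h \<in> G" "g @ v = h @ w" for g h v w
        by (rule prefix_free_append_inj[OF prefix_free that])
      have "inj_on (\<lambda>(g, w). g @ w) (G \<times> word_powers G n)"
      proof (rule inj_onI)
        fix x y assume "x \<in> G \<times> word_powers G n" "y \<in> G \<times> word_powers G n"
          "(\<lambda>(g, w). g @ w) x = (\<lambda>(g, w). g @ w) y"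
        then show "x = y"
          using cancel[of "fst x" "fst y" "snd x" "snd y"]
          by (simp add: case_prod_unfold prod_eq_iff mem_Times_iff)
      qed
      then show ?thesis by (simp add: sum.reindex case_prod_unfold o_def)
    qed
    finally show ?case .
  qed simp
  show "w \<in> word_powers G n \<Longrightarrow> n * \<delta> \<le> wsum \<psi> w"
  proof (induction n arbitrary: w)
    case 0
    then show ?case using wsum_\<psi>_nonneg[OF nil] by simp
  next
    case (Suc n)
    then obtain g v where w: "w = g @ v" "g \<in> G" "v \<in> word_powers G n" by auto
    have "\<bar>wsum \<psi> w - wsum \<psi> g - wsum \<psi> v\<bar> \<le> 3 * C"
      unfolding w(1) using gw[OF w(2,3)] by (intro wsum_append) auto
    with Suc.IH[OF w(3)] bspec[OF long w(2)] show ?case by (simp add: abs_le_iff algebra_simps)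
  qed
qed

text \<open>The sum of \<psi> over one period of \<open>periodic v\<close> is positive, and this
  point lies in the cylinders of all powers of \<open>v\<close>, so the \<psi>-sums of the powers
  grow at least linearly.\<close>

lemma exists_long_per_word:
  assumes "v \<in> per_words I A a"
  obtains u where "u \<in> per_words I A a" "R \<le> wsum \<psi> u"
proof -
  let ?x = "periodic v" and ?n = "length v"
  have v: "v \<noteq> []" using assms by (auto simp: per_words_iff words_def)
  have x: "?x \<in> cyl v" using assms by (rule periodic_in_cylinder)
  then have "?x \<in> \<Sigma>" using cylinder_subset by blast
  then have pos: "bsum \<psi> ?n ?x > 0"
    unfolding bsum_def using v by (intro sum_pos \<psi>_pos funpow_shift_in_shift_space) auto
  have iter: "(shift ^^ ?n) ?x = ?x" by (simp add: funpow_shift periodic_def)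
  have "?x \<in> cyl (concat (replicate m v)) \<and>
      bsum \<psi> (length (concat (replicate m v))) ?x = m * bsum \<psi> ?n ?x" for m
  proof (induction m)
    case 0
    show ?case using \<open>?x \<in> \<Sigma>\<close> by (simp add: cylinder_def bsum_def)
  next
    case (Suc m)
    then show ?case using x by (simp add: in_cylinder_append_iff bsum_add iter algebra_simps)
  qed
  note iterates = this
  have "m * bsum \<psi> ?n ?x \<le> wsum \<psi> (concat (replicate m v))" for m
    using wsum_bounds(1)[of \<psi>, OF _ conjunct1[OF iterates[of m]]] conjunct2[OF iterates[of m]]
    by simp
  moreover obtain m where "R < real m * bsum \<psi> ?n ?x"
    using reals_Archimedean3[OF pos] by blast
  \<comment> \<open>The shift to \<open>Suc m\<close> excludes the empty power, which is not a
    loop.\<close>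
  then have "R < real (Suc m) * bsum \<psi> ?n ?x" using pos by (simp add: algebra_simps)
  moreover have "concat (replicate (Suc m) v) \<in> per_words I A a" for m
    by (induction m) (use assms per_words_append in auto)
  ultimately show ?thesis by (meson less_imp_le order_trans that)
qed

text \<open>
  The lower bound on \<open>\<psi>\<close>-sums makes them grow linearly along products; it cannot be taken from \<open>\<psi>\<close>
  itself, whose infimum may be 0.
\<close>

lemma heavy_prefix_free_family:
  assumes s: "ereal s < induced_pressure I A \<eta> \<psi> \<phi> (per_words I A a)" and \<eta>: "\<eta> > 0"
  obtains G where "finite G" "G \<subseteq> per_words I A a" "prefix_free G"
    "\<forall>g\<in>G. \<eta> + 3 * C \<le> wsum \<psi> g"
    "2 * exp (3 * C * (1 + \<bar>s\<bar>)) \<le> (\<Sum>g\<in>G. p s g)"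
proof -
  have heavy_window: "\<exists>T F. finite F \<and> F \<subseteq> {w \<in> per_words I A a. T - \<eta> < wsum \<psi> w \<and> wsum \<psi> w \<le> T}
      \<and> M < (\<Sum>w\<in>F. p s w)" for M
  proof (rule ccontr)
    assume "\<not> ?thesis"
    then have "(\<Sum>w\<in>F. p s w) \<le> M"
      if "finite F" "F \<subseteq> {w \<in> per_words I A a. T - \<eta> < wsum \<psi> w \<and> wsum \<psi> w \<le> T}" for T F
      using that by (meson not_less)
    then have "exponent \<eta> (wsum \<psi>) (wsum \<phi>) (per_words I A a \<inter> lang) \<le> ereal s"
      using per_words_subset_lang
      by (intro exponent_le_if_windows_bounded[of 0]) (simp_all add: Int_absorb2)
    with s show False by (simp add: induced_pressure_eq_exponent)
  qed
  \<comment> \<open>The bound 0 already forces some window to be nonempty, which provides a first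
    loop.\<close>
  from heavy_window[of 0] obtain v where "v \<in> per_words I A a" by fastforce
  \<comment> \<open>One \<open>3 * C\<close> covers the concatenation of \<open>w\<close> with
    \<open>u\<close>, the other the extension of \<open>w @ u\<close> by further letters; what
    remains is at least the window width.\<close>
  then obtain u where u: "u \<in> per_words I A a" "\<eta> + 6 * C \<le> wsum \<psi> u"
    by (rule exists_long_per_word)
  then have len: "length u > 0" by (auto simp: per_words_iff words_def)
  let ?D = "exp (3 * C * (1 + \<bar>s\<bar>))"
  \<comment> \<open>Chosen backwards: the pigeonhole principle over the \<open>length u\<close>
    residues leaves weight above \<open>M\<close>, and appending \<open>u\<close> costs at most the
    factor \<open>p s u / ?D\<close>, which leaves \<open>2 * ?D\<close>.\<close>
  define M where "M = 2 * ?D * ?D / p s u"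
  obtain T F where F: "finite F" "F \<subseteq> {w \<in> per_words I A a. T - \<eta> < wsum \<psi> w \<and> wsum \<psi> w \<le> T}"
    and large: "length u * M < (\<Sum>w\<in>F. p s w)"
    using heavy_window[of "length u * M"] by blast
  define F' where "F' r = {w \<in> F. length w mod length u = r}" for r
  obtain r where r: "M < (\<Sum>w\<in>F' r. p s w)"
  proof (rule ccontr)
    assume "\<not> thesis"
    then have "(\<Sum>w\<in>F' r. p s w) \<le> M" for r using that[of r] by linarith
    then have "(\<Sum>r<length u. \<Sum>w\<in>F' r. p s w) \<le> (\<Sum>r<length u. M)" by (rule sum_mono)
    moreover have "(\<Sum>w\<in>F. p s w) = (\<Sum>r<length u. \<Sum>w\<in>F' r. p s w)"
      unfolding F'_def by (rule sum.group[symmetric]) (use F len in auto)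
    ultimately show False using large by simp
  qed
  have app: "w @ u \<in> per_words I A a" if "w \<in> F" for w
    using F u that by (auto intro: per_words_append)
  show ?thesis
  proof (rule that[of "(\<lambda>w. w @ u) ` F' r"])
    show "finite ((\<lambda>w. w @ u) ` F' r)" "(\<lambda>w. w @ u) ` F' r \<subseteq> per_words I A a"
      using F app by (auto simp: F'_def)
    have step: "\<eta> + 3 * C \<le> wsum \<psi> (w @ u) \<and> wsum \<psi> w + wsum \<psi> u - 3 * C \<le> wsum \<psi> (w @ u)"
      if "w \<in> F" for w
    proof -
      have wu: "w @ u \<in> lang" using app[OF that] per_words_subset_lang by blast
      have "\<bar>wsum \<psi> (w @ u) - wsum \<psi> w - wsum \<psi> u\<bar> \<le> 3 * C"
        by (rule wsum_append[OF _ wu]) simp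
      with u(2) wsum_\<psi>_nonneg[OF lang_append(1)[OF wu]] show ?thesis by linarith
    qed
    then show "\<forall>g\<in>(\<lambda>w. w @ u) ` F' r. \<eta> + 3 * C \<le> wsum \<psi> g" by (auto simp: F'_def)
    \<comment> \<open>If \<open>w @ u\<close> were a proper prefix of \<open>w' @ u\<close>, the
      lengths of \<open>w\<close> and \<open>w'\<close> would differ by a positive multiple of
      \<open>length u\<close>. Then \<open>w @ u\<close> is already a prefix of \<open>w'\<close>,
      and the \<psi>-sum of \<open>u\<close> pushes \<open>w'\<close> out of the window.\<close>
    have "z = []" if w: "w \<in> F" "length w mod length u = r"
      and w': "w' \<in> F" "length w' mod length u = r" and z: "w @ u @ z = w' @ u" for w w' z
    proof (rule ccontr)
      assume "z \<noteq> []"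
      have len_w': "length w' = length w + length z"
        using arg_cong[OF z, of length] by simp
      have "length u dvd length w' - length w"
        using w'(2) w(2) len_w' by (metis mod_eq_dvd_iff_nat le_add1)
      moreover have "length w' - length w = length z" using len_w' by simp
      ultimately have le: "length u \<le> length z" using \<open>z \<noteq> []\<close> by (simp add: dvd_imp_le)
      \<comment> \<open>This is \<open>z\<close> without its last \<open>length u\<close> letters,
        which form the final \<open>u\<close> of \<open>w' @ u\<close>.\<close>
      define y where "y = take (length z - length u) z"
      have "take (length w') (w @ u @ z) = w @ u @ y"
        using len_w' le by (simp add: y_def)
      then have split: "w' = (w @ u) @ y" using z by simp
      have w'_lang: "(w @ u) @ y \<in> lang" using w'(1) F per_words_subset_lang split by blast
      have "\<bar>wsum \<psi> w' - wsum \<psi> (w @ u) - wsum \<psi> y\<bar> \<le> 3 * C"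
        unfolding split by (rule wsum_append[OF _ w'_lang]) simp
      moreover have "wsum \<psi> y \<ge> 0" by (rule wsum_\<psi>_nonneg[OF lang_append(2)[OF w'_lang]])
      moreover have "T - \<eta> < wsum \<psi> w" "wsum \<psi> w' \<le> T" using F w(1) w'(1) by auto
      ultimately show False using u(2) step[OF w(1)] by linarith
    qed
    then show "prefix_free ((\<lambda>w. w @ u) ` F' r)" by (auto simp: prefix_free_def F'_def)
  next
    have "p s u \<noteq> 0" by (simp add: weight_def)
    then have "2 * ?D = M * (p s u / ?D)" by (simp add: M_def)
    also have "\<dots> \<le> (\<Sum>w\<in>F' r. p s w) * (p s u / ?D)" using r by (intro mult_right_mono) auto
    also have "\<dots> = (\<Sum>w\<in>F' r. p s w * p s u / ?D)" by (simp add: sum_distrib_right sum_divide_distrib)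
    also have "\<dots> \<le> (\<Sum>w\<in>F' r. p s (w @ u))"
    proof (rule sum_mono)
      fix w assume "w \<in> F' r"
      then have "w @ u \<in> lang" using app per_words_subset_lang by (auto simp: F'_def)
      from weight_append(2)[OF this] show "p s w * p s u / ?D \<le> p s (w @ u)"
        by (simp add: divide_le_eq mult.commute)
    qed
    also have "\<dots> = (\<Sum>g\<in>(\<lambda>w. w @ u) ` F' r. p s g)"
      by (subst sum.reindex) (auto simp: inj_on_def)
    finally show "2 * ?D \<le> (\<Sum>g\<in>(\<lambda>w. w @ u) ` F' r. p s g)" .
  qed
qed

text \<open>\<open>J\<close> collects the letters of a heavy prefix-free family. Its
  \<open>n\<close>-fold products are loops over \<open>J\<close> that lie in any given tail for
  large \<open>n\<close>, while their total weight grows at least like \<open>2 ^ n\<close>.\<close>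

lemma finite_alphabet_not_summable:
  assumes s: "ereal s < induced_pressure I A \<eta> \<psi> \<phi> (per_words I A a)" and \<eta>: "\<eta> > 0"
  obtains J where "finite J"
    "\<And>T0. \<not> p s summable_on {w \<in> per_words I A a. set w \<subseteq> J \<and> T0 \<le> wsum \<psi> w}"
proof -
  from heavy_prefix_free_family[OF s \<eta>] obtain G where G: "finite G" "G \<subseteq> per_words I A a"
    and prefix_free: "prefix_free G"
    and long: "\<forall>g\<in>G. \<eta> + 3 * C \<le> wsum \<psi> g"
    and heavy: "2 * exp (3 * C * (1 + \<bar>s\<bar>)) \<le> (\<Sum>g\<in>G. p s g)"
    by blast
  note growth = word_powers_weight_growth[OF G _ prefix_free long heavy]
  define J where "J = \<Union> (set ` G)"
  have letters: "w \<in> word_powers G n \<Longrightarrow> set w \<subseteq> J" for w n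
    by (induction n arbitrary: w) (fastforce simp: J_def)+
  have "\<not> p s summable_on {w \<in> per_words I A a. set w \<subseteq> J \<and> T0 \<le> wsum \<psi> w}" for T0
  proof
    let ?S = "{w \<in> per_words I A a. set w \<subseteq> J \<and> T0 \<le> wsum \<psi> w}"
    assume summable: "p s summable_on ?S"
    obtain n1 where n1: "T0 < real n1 * \<eta>"
      using reals_Archimedean3[OF \<eta>] by blast
    obtain n2 where n2: "infsum (p s) ?S / p s [] < 2 ^ n2"
      using real_arch_pow[of 2] by auto
    \<comment> \<open>\<open>n1\<close> places the products in the tail, \<open>n2\<close> makes
      them too heavy, and \<open>Suc\<close> makes them nonempty.\<close>
    define n where "n = Suc (n1 + n2)"
    have len: "T0 \<le> real n * \<eta>"
    proof -
      have "real n1 * \<eta> \<le> real n * \<eta>" using \<eta> by (intro mult_right_mono) (auto simp: n_def)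
      with n1 show ?thesis by simp
    qed
    have nil: "[] \<notin> G" using G(2) by (auto simp: per_words_iff words_def)
    then have "[] \<notin> word_powers G n" by (auto simp: n_def)
    then have sub: "word_powers G n \<subseteq> ?S"
      using word_powers_per_words[OF G(2), of n] letters growth(2)[where n = n] len \<eta> by force
    have "infsum (p s) ?S < 2 ^ n2 * p s []" using n2 by (simp add: divide_less_eq)
    also have "\<dots> \<le> 2 ^ n * p s []" by (intro mult_right_mono power_increasing) (auto simp: n_def)
    also have "\<dots> \<le> (\<Sum>w\<in>word_powers G n. p s w)" using growth(1) \<eta> by simp
    also have "\<dots> \<le> infsum (p s) ?S"
      by (intro finite_sum_le_infsum summable sub finite_word_powers G) auto
    finally show False by simp
  qed
  moreover have "finite J" using G(1) by (simp add: J_def)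
  ultimately show ?thesis using that by blast
qed

section \<open>Upper bounds: from loops to all words over a finite alphabet\<close>

lemma wsum_extend:
  assumes f: "f \<in> {\<phi>, \<psi>}" and lang: "u @ w @ v \<in> lang"
  shows "\<bar>wsum f (u @ w @ v) - wsum f w\<bar> \<le> 6 * C + \<bar>wsum f u\<bar> + \<bar>wsum f v\<bar>"
  using wsum_append[OF f lang] wsum_append[OF f lang_append(2)[OF lang]]
  by linarith

text \<open>For fixed first letter \<open>i\<close> and last letter \<open>j\<close>, one pair of
  connecting words turns every word into a loop at \<open>a\<close>, injectively and with bounded
  change of the sums. Finiteness of \<open>J\<close> leaves finitely many pairs.\<close>

lemma summable_component_words:
  assumes summable: "p s summable_on {w \<in> per_words I A a. T0 \<le> wsum \<psi> w}"
    and J: "finite J"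
    and W: "\<And>w. w \<in> W \<Longrightarrow> w \<in> words I A \<and> set w \<subseteq> J \<and> leads_to I A a (hd w) \<and> leads_to I A (last w) a"
  obtains T1 where "p s summable_on {w \<in> W. T1 \<le> wsum \<psi> w}"
proof -
  define B where "B = (\<lambda>(i, j). {w \<in> W. hd w = i \<and> last w = j})"
  have "\<forall>ij \<in> J \<times> J. \<exists>T. p s summable_on {w \<in> B ij. T \<le> wsum \<psi> w}"
  proof clarify
    fix i j
    show "\<exists>T. p s summable_on {w \<in> B (i, j). T \<le> wsum \<psi> w}"
    proof (cases "B (i, j) = {}")
      case False
      then have "leads_to I A a i" "leads_to I A j a" using W by (auto simp: B_def)
      then obtain u v where u: "u \<in> words I A" "a # u @ [i] \<in> words I A"
        and v: "v \<in> words I A" "j # v @ [a] \<in> words I A"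
        by (auto simp: leads_to_def)
      \<comment> \<open>The loop contains the initial \<open>a\<close> but not the one reached after
        \<open>v\<close>, which begins the next period.\<close>
      have ext: "(a # u) @ w @ v \<in> per_words I A a" if "w \<in> B (i, j)" for w
      proof -
        have w: "w \<in> words I A" "w \<noteq> []" "hd w = i" "last w = j"
          using W[of w] that by (auto simp: B_def words_def)
        have ne: "u \<noteq> []" "v \<noteq> []" using u v by (auto simp: words_def)
        have "(a # u) \<in> words I A" "A (last u) i"
          using u words_append_iff[of "a # u" "[i]" I A] ne by auto
        moreover have "v @ [a] \<in> words I A" "A j (hd v)"
          using v(2) words_append_iff[of "[j]" "v @ [a]" I A] ne by auto
        moreover have "A (last v) a"
          using calculation(3) words_append_iff[of v "[a]" I A] ne by auto
        ultimately show ?thesis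
          using w ne v(1) words_append_iff[of "a # u" "w @ v" I A] words_append_iff[of w v I A]
          by (auto simp: per_words_iff)
      qed
      define D where "D = 6 * C + (\<bar>wsum \<psi> (a # u)\<bar> + \<bar>wsum \<psi> v\<bar>) + (\<bar>wsum \<phi> (a # u)\<bar> + \<bar>wsum \<phi> v\<bar>)"
      have D: "\<bar>wsum f ((a # u) @ w @ v) - wsum f w\<bar> \<le> D" if "w \<in> B (i, j)" "f \<in> {\<phi>, \<psi>}" for w f
      proof -
        have "(a # u) @ w @ v \<in> lang" using ext[OF that(1)] per_words_subset_lang by blast
        from wsum_extend[OF that(2) this] that(2) show ?thesis by (auto simp: D_def)
      qed
      have "p s summable_on {w \<in> B (i, j). T0 + D \<le> wsum \<psi> w}"
        by (rule summable_weight_transfer[OF summable, of "\<lambda>w. (a # u) @ w @ v"])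
          (use ext D in \<open>auto simp: inj_on_def\<close>)
      then show ?thesis by blast
    qed simp
  qed
  then obtain T where T: "\<And>ij. ij \<in> J \<times> J \<Longrightarrow> p s summable_on {w \<in> B ij. T ij \<le> wsum \<psi> w}"
    by metis
  \<comment> \<open>Including 0 gives \<open>Max\<close> a value when \<open>J\<close> is
    empty.\<close>
  define T1 where "T1 = Max (insert 0 (T ` (J \<times> J)))"
  have "p s summable_on {w \<in> W. T1 \<le> wsum \<psi> w}"
  proof (rule summable_on_finite_cover)
    show "finite (J \<times> J)" using J by simp
    show "p s summable_on {w \<in> B ij. T ij \<le> wsum \<psi> w}" if "ij \<in> J \<times> J" for ij
      using that by (rule T)
    show "{w \<in> W. T1 \<le> wsum \<psi> w} \<subseteq> (\<Union>ij\<in>J \<times> J. {w \<in> B ij. T ij \<le> wsum \<psi> w})"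
    proof
      fix w assume w: "w \<in> {w \<in> W. T1 \<le> wsum \<psi> w}"
      then have "w \<noteq> []" "set w \<subseteq> J" using W[of w] by (auto simp: words_def)
      then have ij: "(hd w, last w) \<in> J \<times> J" by auto
      then have "T (hd w, last w) \<le> T1" unfolding T1_def using J by (intro Max_ge) auto
      with w ij show "w \<in> (\<Union>ij\<in>J \<times> J. {w \<in> B ij. T ij \<le> wsum \<psi> w})"
        by (intro UN_I[of "(hd w, last w)"]) (auto simp: B_def)
    qed
  qed
  then show ?thesis using that by blast
qed

text \<open>Induction on the set of allowed letters. A word containing the new letter
  \<open>a\<close> factors as \<open>x @ v @ y\<close> with \<open>v\<close> running from the first
  to the last \<open>a\<close>, and the product series over such triples dominates. The factors may
  have small \<psi>-sums, so the whole series has to converge and not only a tail; the lower bound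
  \<open>c\<close> ensures this by leaving finitely many words below any threshold.\<close>

lemma summable_words_meeting:
  assumes \<eta>: "\<eta> > 0"
    and s: "\<And>a. a \<in> I \<Longrightarrow> induced_pressure I A \<eta> \<psi> \<phi> (per_words I A a) < ereal s"
    and K: "K \<subseteq> \<Sigma>" "invariant K"
    and J: "finite J" "\<And>x i. x \<in> K \<Longrightarrow> x i \<in> J"
    and c: "c > 0" "\<And>x. x \<in> K \<Longrightarrow> c \<le> \<psi> x"
  shows "p s summable_on {w. cyl w \<inter> K \<noteq> {}}"
proof -
  define L where "L = {w. cyl w \<inter> K \<noteq> {}}"
  have iter: "(shift ^^ k) x \<in> K" if "x \<in> K" for x k
    using that K(2) by (induction k) (auto simp: invariant_def)
  have L_append: "u \<in> L" "v \<in> L" if "u @ v \<in> L" for u v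
    using that iter by (auto simp: L_def in_cylinder_append_iff)
  have L_lang: "L \<subseteq> lang" by (auto simp: L_def lang_def)
  have L_words: "w \<in> words I A" if "w \<in> L" "w \<noteq> []" for w
    using that cylinder_nonempty_word by (auto simp: L_def)
  have L_set: "set w \<subseteq> J" if w: "w \<in> L" for w
  proof -
    obtain x where "x \<in> cyl w" "x \<in> K" using w by (auto simp: L_def)
    then have "w ! i \<in> J" if "i < length w" for i
      using J(2)[of x i] that by (simp add: cylinder_def)
    then show ?thesis by (auto simp: in_set_conv_nth)
  qed
  have L_finite: "finite {w \<in> L. wsum \<psi> w < T}" for T
  proof (rule finite_subset)
    show "{w \<in> L. wsum \<psi> w < T} \<subseteq> {w. set w \<subseteq> J \<and> length w \<le> nat \<lceil>T / c\<rceil>}"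
    proof clarify
      fix w assume w: "w \<in> L" "wsum \<psi> w < T"
      then obtain x where x: "x \<in> cyl w" "x \<in> K" by (auto simp: L_def)
      have "real (length w) * c = (\<Sum>k<length w. c)" by simp
      also have "\<dots> \<le> bsum \<psi> (length w) x"
        unfolding bsum_def using x iter c by (intro sum_mono) auto
      also have "\<dots> \<le> wsum \<psi> w" by (rule wsum_bounds(1)[OF _ x(1)]) simp
      finally have "real (length w) \<le> T / c" using w(2) c(1) by (simp add: field_simps)
      then show "set w \<subseteq> J \<and> length w \<le> nat \<lceil>T / c\<rceil>"
        using L_set[OF w(1)] by linarith
    qed
  qed (use J(1) finite_lists_length_le in blast)
  let ?D = "exp (3 * C * (1 + \<bar>s\<bar>))"
  \<comment> \<open>Such a word ends with \<open>a\<close>; dropping this letter yields an element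
    of \<open>per_words\<close>, except for the single-letter word \<open>[a]\<close>, which is
    treated apart.\<close>
  have loops: "p s summable_on {w \<in> L. w \<noteq> [] \<and> hd w = a \<and> last w = a}" (is "_ summable_on ?V")
    if a: "a \<in> I" for a
  proof -
    have "pressure_within I A \<Sigma> \<eta> \<psi> \<phi> (per_words I A a) < ereal s"
      using s[OF a] by (simp add: induced_pressure_def)
    then obtain T0 where T0:
      "p s summable_on {w \<in> per_words I A a. cyl w \<inter> \<Sigma> \<noteq> {} \<and> T0 \<le> wsum \<psi> w}"
      by (rule summable_if_pressure_less[OF \<eta> order_refl])
    have per: "p s summable_on (L \<inter> per_words I A a)"
    proof (rule summable_on_finite_cover[of "UNIV :: bool set" _
          "\<lambda>b. if b then {w \<in> per_words I A a. cyl w \<inter> \<Sigma> \<noteq> {} \<and> T0 \<le> wsum \<psi> w}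
             else {w \<in> L. wsum \<psi> w < T0}"])
      fix b
      show "p s summable_on (if b then {w \<in> per_words I A a. cyl w \<inter> \<Sigma> \<noteq> {} \<and> T0 \<le> wsum \<psi> w}
             else {w \<in> L. wsum \<psi> w < T0})"
        using T0 L_finite by simp
      show "L \<inter> per_words I A a \<subseteq> (\<Union>b\<in>UNIV. if b
          then {w \<in> per_words I A a. cyl w \<inter> \<Sigma> \<noteq> {} \<and> T0 \<le> wsum \<psi> w}
          else {w \<in> L. wsum \<psi> w < T0})"
        using K(1) by (auto simp: UNIV_bool L_def not_le)
    qed simp
    have V: "butlast w \<in> L \<inter> per_words I A a" "butlast w @ [a] = w"
      if "w \<in> ?V - {[a]}" for w
    proof -
      show w: "butlast w @ [a] = w" using that append_butlast_last_id[of w] by auto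
      then have ne: "butlast w \<noteq> []" using that by (intro notI) simp
      have wL: "butlast w @ [a] \<in> L" unfolding w using that by simp
      then have "butlast w @ [a] \<in> words I A" by (rule L_words) simp
      then have "butlast w \<in> words I A" "A (last (butlast w)) a"
        using ne by (simp_all add: words_append_iff)
      moreover have "hd (butlast w) = a"
      proof -
        have "hd (butlast w @ [a]) = a" unfolding w using that by simp
        with ne show ?thesis by simp
      qed
      moreover have "butlast w \<in> L" using L_append(1)[OF wL] .
      ultimately show "butlast w \<in> L \<inter> per_words I A a" by (simp add: per_words_iff)
    qed
    have "p s summable_on (?V - {[a]})"
    proof (rule summable_on_dominated_inj[OF _ _ per])
      show "inj_on butlast (?V - {[a]})" by (rule inj_on_inverseI[of _ "\<lambda>b. b @ [a]"]) (rule V(2))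
      show "butlast ` (?V - {[a]}) \<subseteq> L \<inter> per_words I A a" using V(1) by blast
      fix w assume w: "w \<in> ?V - {[a]}"
      have "butlast w @ [a] \<in> lang" unfolding V(2)[OF w] using w L_lang by auto
      from weight_append(1)[OF this, of s, unfolded V(2)[OF w]]
      show "p s w \<le> (?D * p s [a]) * p s (butlast w)" by (simp add: ac_simps)
    qed simp
    then have "p s summable_on ((?V - {[a]}) \<union> (?V \<inter> {[a]}))"
      by (intro summable_on_Un_disjoint) auto
    then show ?thesis by (simp add: Un_Diff_Int)
  qed
  have "p s summable_on {w \<in> L. set w \<subseteq> J'}" if "finite J'" "J' \<subseteq> I" for J'
    using that
  proof (induction J')
    case empty
    have "{w \<in> L. set w \<subseteq> {}} \<subseteq> {[]}" by auto
    then show ?case using finite_subset by fastforce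
  next
    case (insert a J')
    let ?S = "{w \<in> L. set w \<subseteq> insert a J' \<and> a \<in> set w}" and ?S' = "{w \<in> L. set w \<subseteq> J'}"
    let ?V = "{w \<in> L. w \<noteq> [] \<and> hd w = a \<and> last w = a}"
    have S': "p s summable_on ?S'" using insert by blast
    have V: "p s summable_on ?V" using insert loops by blast
    \<comment> \<open>Any choice of decomposition will do: concatenation recovers \<open>w\<close>,
      which makes \<open>h\<close> injective.\<close>
    define h where "h w = (SOME (x, v, y). w = x @ v @ y \<and> (x, v, y) \<in> ?S' \<times> ?V \<times> ?S')" for w
    have h: "case h w of (x, v, y) \<Rightarrow> w = x @ v @ y \<and> (x, v, y) \<in> ?S' \<times> ?V \<times> ?S'"
      if w: "w \<in> ?S" for w
      unfolding h_def
    proof (rule someI_ex)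
      obtain x t where x: "w = x @ a # t" "a \<notin> set x" using split_list_first[of a w] w by auto
      obtain r y where y: "a # t = r @ a # y" "a \<notin> set y" using split_list_last[of a "a # t"] by auto
      have eq: "w = x @ (r @ [a]) @ y" using x y by simp
      have "hd (r @ [a]) = a" using y(1) by (cases r) auto
      moreover have "x \<in> L" "r @ [a] \<in> L" "y \<in> L"
        using w eq L_append[of x "(r @ [a]) @ y"] L_append[of "r @ [a]" y] by auto
      moreover have "set x \<subseteq> J'" "set y \<subseteq> J'" using w eq x(2) y(2) by auto
      ultimately show "\<exists>t. case t of (x, v, y) \<Rightarrow> w = x @ v @ y \<and> (x, v, y) \<in> ?S' \<times> ?V \<times> ?S'"
        by (intro exI[of _ "(x, r @ [a], y)"]) (simp add: eq)
    qed
    have prod: "(\<lambda>(x, v, y). p s x * (case (v, y) of (v, y) \<Rightarrow> p s v * p s y)) summable_on ?S' \<times> ?V \<times> ?S'"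
      using summable_on_times[OF S' summable_on_times[OF V S']] by (simp add: case_prod_unfold)
    have "p s summable_on ?S"
    proof (rule summable_on_dominated_inj[OF _ _ prod])
      show "inj_on h ?S"
      proof (rule inj_on_inverseI[of _ "\<lambda>(x, v, y). x @ v @ y"])
        show "(case h w of (x, v, y) \<Rightarrow> x @ v @ y) = w" if "w \<in> ?S" for w
          using h[OF that] by (cases "h w") simp
      qed
      show "h ` ?S \<subseteq> ?S' \<times> ?V \<times> ?S'"
      proof (rule image_subsetI)
        show "h w \<in> ?S' \<times> ?V \<times> ?S'" if "w \<in> ?S" for w
          using h[OF that] by (cases "h w") simp
      qed
      fix w assume w: "w \<in> ?S"
      obtain x v y where hw: "h w = (x, v, y)" by (cases "h w")
      then have eq: "w = x @ v @ y" using h[OF w] by simp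
      then have lang: "x @ v @ y \<in> lang" using w L_lang by auto
      have "p s w \<le> ?D * (p s x * p s (v @ y))"
        using weight_append(1)[OF lang] eq by simp
      also have "\<dots> \<le> ?D * (p s x * (?D * (p s v * p s y)))"
        by (intro mult_left_mono weight_append(1) lang_append(2)[OF lang]) auto
      finally show "p s w \<le> (?D * ?D) * (case h w of (x, v, y) \<Rightarrow>
          p s x * (case (v, y) of (v, y) \<Rightarrow> p s v * p s y))" by (simp add: hw ac_simps)
    qed simp
    then have "p s summable_on (?S' - ?S) \<union> ?S"
      using S' by (intro summable_on_Un_disjoint) (auto intro: summable_on_subset_banach)
    then show ?case by (rule summable_on_subset_banach) auto
  qed
  from this[of "J \<inter> I"] have "p s summable_on {w \<in> L. set w \<subseteq> J \<inter> I}"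
    using J(1) by (simp del: Int_subset_iff le_inf_iff)
  moreover have "L = {w \<in> L. set w \<subseteq> J \<inter> I}"
  proof -
    have "set w \<subseteq> I" if "w \<in> L" for w
      using L_words[OF that] by (cases "w = []") (auto simp: words_def)
    then show ?thesis using L_set by auto
  qed
  ultimately show ?thesis by (simp add: L_def)
qed

end

section \<open>Compact invariant sets\<close>

lemma d_shift_less_imp_agree:
  assumes "d_shift 1 x y < exp (- real n)" "i < n"
  shows "x i = y i"
proof -
  have "enat n \<le> common_length x y"
    using assms(1) by (auto simp: d_shift_def split: enat.splits)
  then show ?thesis using assms(2) by (simp add: common_length_ge_iff)
qed

lemma agree_imp_d_shift_le:
  assumes "\<And>i. i < n \<Longrightarrow> x i = y i"
  shows "d_shift 1 x y \<le> exp (- real n)"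
proof -
  have "enat n \<le> common_length x y" using assms by (simp add: common_length_ge_iff)
  then show ?thesis by (auto simp: d_shift_def split: enat.splits)
qed

text \<open>A violation is visible on two consecutive coordinates, so the complement is a union of
  open sets of the product topology.\<close>

lemma closed_finite_alphabet_shift: "closed {x \<in> shift_space I A. \<forall>i. x i \<in> J}"
proof -
  let ?P = "\<lambda>m n. m \<in> I \<and> m \<in> J \<and> A m n"
  have coord: "open {x :: nat \<Rightarrow> nat. x i = m}" for i m
  proof -
    have "open ((\<lambda>x :: nat \<Rightarrow> nat. x i) -` {m})"
      by (intro open_vimage open_discrete continuous_on_product_coordinates)
    then show ?thesis by (simp add: vimage_def)
  qed
  have "- {x \<in> shift_space I A. \<forall>i. x i \<in> J}
      = (\<Union>i. \<Union>m. \<Union>n\<in>{n. \<not> ?P m n}. {x. x i = m} \<inter> {x. x (Suc i) = n})"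
    by (auto simp: shift_space_def)
  moreover have "open \<dots>" by (intro open_UN open_Int ballI coord)
  ultimately show ?thesis by (simp add: closed_def)
qed

text \<open>Tychonoff's theorem yields compactness in the product topology; the identity is
  continuous into the metric topology and carries it over.\<close>

lemma finite_alphabet_shift_compact_invariant:
  assumes "finite J"
  shows "{x \<in> shift_space I A. \<forall>i. x i \<in> J} \<in> compact_invariant I A"
proof -
  let ?K = "{x \<in> shift_space I A. \<forall>i. x i \<in> J}"
  interpret M: Metric_space "shift_space I A" "d_shift 1" by (rule Metric_space_d_shift) simp
  have "compactin (product_topology (\<lambda>_. euclidean) UNIV) (PiE UNIV (\<lambda>_::nat. J))"
    unfolding compactin_PiE using assms by (simp add: finite_imp_compact)
  then have "compact (PiE UNIV (\<lambda>_::nat. J))" by (simp add: euclidean_product_topology)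
  then have "compact (PiE UNIV (\<lambda>_::nat. J) \<inter> ?K)"
    using closed_finite_alphabet_shift by (rule compact_Int_closed)
  moreover have "PiE UNIV (\<lambda>_::nat. J) \<inter> ?K = ?K" by auto
  ultimately have "compact ?K" by simp
  then have "compactin (top_of_set ?K) ?K" by (simp add: compactin_subtopology)
  moreover have "continuous_map (top_of_set ?K) M.mtopology (\<lambda>x. x)"
    unfolding continuous_map_def
  proof (intro conjI allI impI)
    fix U assume U: "openin M.mtopology U"
    show "openin (top_of_set ?K) {x \<in> topspace (top_of_set ?K). x \<in> U}"
    proof (subst openin_subopen, safe)
      fix x assume "x \<in> topspace (top_of_set ?K)" "x \<in> U"
      then have x: "x \<in> shift_space I A" "\<forall>i. x i \<in> J" by auto
      obtain r where r: "r > 0" "M.mball x r \<subseteq> U" using U \<open>x \<in> U\<close> by (auto simp: M.openin_mtopology)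
      have "(\<lambda>n. exp (- real n)) \<longlonglongrightarrow> 0"
        by (rule filterlim_compose[OF exp_at_bot])
          (simp add: filterlim_uminus_at_bot filterlim_real_sequentially)
      then have "\<forall>\<^sub>F n in sequentially. exp (- real n) < r" using r(1) by (rule order_tendstoD)
      then obtain n where n: "exp (- real n) < r" by (auto simp: eventually_sequentially)
      \<comment> \<open>This set is open in the product topology, and its points in
        \<open>?K\<close> are within \<open>exp (- real n)\<close> of \<open>x\<close>.\<close>
      let ?V = "{y. \<forall>i\<in>{..<n}. y i \<in> {x i}}"
      have "open ?V" by (rule product_topology_basis') (auto intro: open_discrete)
      then have "openin (top_of_set ?K) (?K \<inter> ?V)" by (rule openin_open_Int)
      moreover have "x \<in> ?K \<inter> ?V" using x by simp
      moreover have "?K \<inter> ?V \<subseteq> {x \<in> topspace (top_of_set ?K). x \<in> U}"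
      proof
        fix y assume y: "y \<in> ?K \<inter> ?V"
        then have "d_shift 1 x y \<le> exp (- real n)" by (intro agree_imp_d_shift_le) simp
        with n have "d_shift 1 x y < r" by simp
        with y x have "y \<in> M.mball x r" by simp
        with r y show "y \<in> {x \<in> topspace (top_of_set ?K). x \<in> U}" by auto
      qed
      ultimately show "\<exists>T. openin (top_of_set ?K) T \<and> x \<in> T
          \<and> T \<subseteq> {x \<in> topspace (top_of_set ?K). x \<in> U}" by blast
    qed
  qed auto
  ultimately have "compactin M.mtopology ((\<lambda>x. x) ` ?K)" by (rule image_compactin)
  then show ?thesis
    unfolding compact_invariant_def shift_topology_def
    by (auto simp: invariant_def shift_def shift_space_def)
qed

lemma compact_invariant_subset:
  assumes "K \<in> compact_invariant I A"
  shows "K \<subseteq> shift_space I A"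
proof -
  interpret M: Metric_space "shift_space I A" "d_shift 1" by (rule Metric_space_d_shift) simp
  show ?thesis
    using assms compactin_subset_topspace
    by (fastforce simp: compact_invariant_def shift_topology_def)
qed

text \<open>The form in which compactness is applied: near every point some \<open>Q n\<close>
  holds, a finite subcover leaves finitely many \<open>n\<close>, and monotonicity allows the
  largest to be used.\<close>

lemma compact_locally_uniform:
  assumes K: "K \<in> compact_invariant I A"
    and local: "\<And>x. x \<in> shift_space I A \<Longrightarrow>
      \<exists>k n. \<forall>y\<in>shift_space I A. (\<forall>i<k. x i = y i) \<longrightarrow> Q n y"
    and mono: "\<And>m n y. Q m y \<Longrightarrow> m \<le> n \<Longrightarrow> Q n y"
  obtains n :: nat where "\<And>y. y \<in> K \<Longrightarrow> Q n y"
proof -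
  interpret M: Metric_space "shift_space I A" "d_shift 1" by (rule Metric_space_d_shift) simp
  define U where "U n = {x \<in> shift_space I A. \<exists>k. \<forall>y\<in>shift_space I A. (\<forall>i<k. x i = y i) \<longrightarrow> Q n y}" for n
  have U_open: "openin M.mtopology (U n)" for n
    unfolding M.openin_mtopology
  proof (intro conjI allI impI)
    fix x assume "x \<in> U n"
    then obtain k where x: "x \<in> shift_space I A"
      and k: "\<And>y. y \<in> shift_space I A \<Longrightarrow> (\<forall>i<k. x i = y i) \<Longrightarrow> Q n y"
      by (auto simp: U_def)
    have "M.mball x (exp (- real k)) \<subseteq> U n"
    proof
      fix y assume y: "y \<in> M.mball x (exp (- real k))"
      then have "x i = y i" if "i < k" for i using d_shift_less_imp_agree that by auto
      \<comment> \<open>Points of the ball agree with \<open>x\<close> on the first \<open>k\<close>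
        letters, so the same \<open>k\<close> serves them all.\<close>
      then show "y \<in> U n" unfolding U_def using y k by auto
    qed
    then show "\<exists>r>0. M.mball x r \<subseteq> U n" by (intro exI[of _ "exp (- real k)"]) simp
  qed (auto simp: U_def)
  have cover: "K \<subseteq> \<Union> (range U)"
  proof
    fix x assume "x \<in> K"
    then have x: "x \<in> shift_space I A" using compact_invariant_subset[OF K] by blast
    from local[OF x] obtain n where "x \<in> U n" using x unfolding U_def by blast
    then show "x \<in> \<Union> (range U)" by blast
  qed
  have "compactin M.mtopology K"
    using K by (simp add: compact_invariant_def shift_topology_def)
  from compactinD[OF this _ cover] obtain \<F> where \<F>: "finite \<F>" "\<F> \<subseteq> range U" "K \<subseteq> \<Union>\<F>"
    using U_open by blast
  then obtain N where N: "finite N" "\<F> = U ` N" by (meson finite_subset_image)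
  have "Q (Max (insert 0 N)) y" if "y \<in> K" for y
  proof -
    obtain n where n: "n \<in> N" "y \<in> U n" using \<F>(3) N(2) \<open>y \<in> K\<close> by auto
    then have "Q n y" by (auto simp: U_def)
    moreover have "n \<le> Max (insert 0 N)" using N(1) n(1) by simp
    ultimately show ?thesis by (rule mono)
  qed
  then show ?thesis using that by blast
qed

text \<open>The gap \<open>Suc i < j\<close> makes the connecting word nonempty, as
  \<open>leads_to\<close> demands.\<close>

lemma leads_to_later:
  assumes "x \<in> shift_space I A" "Suc i < j"
  shows "leads_to I A (x i) (x j)"
proof -
  have "x i # map x [Suc i..<j] @ [x j] = map x [i..<Suc j]"
    using assms(2) by (simp add: upt_conv_Cons)
  moreover have "map x [Suc i..<j] \<in> words I A" "map x [i..<Suc j] \<in> words I A"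
    using assms by (intro map_upt_in_words; simp)+
  ultimately show ?thesis unfolding leads_to_def by metis
qed

lemma periodic_in_component:
  assumes "w \<in> per_words I A a"
  shows "periodic w \<in> component I A a"
proof -
  let ?x = "periodic w"
  have w: "w \<noteq> []" "hd w = a" and x: "?x \<in> shift_space I A"
    using assms by (auto simp: per_words_def words_def)
  have a: "?x (k * length w) = a" for k using w by (simp add: periodic_def hd_conv_nth)
  have "leads_to I A (?x i) a" for i
  proof -
    \<comment> \<open>The letter \<open>a\<close> recurs at the multiples of
      \<open>length w\<close>; the multiple \<open>(i + 2) * length w\<close> lies beyond
      \<open>Suc i\<close>, leaving room for a connecting word.\<close>
    have "Suc i < (i + 2) * 1" by simp
    also have "\<dots> \<le> (i + 2) * length w"
      by (intro mult_left_mono) (use w in \<open>auto simp: Suc_le_eq\<close>)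
    finally have "Suc i < (i + 2) * length w" .
    from leads_to_later[OF x this] show ?thesis unfolding a .
  qed
  then show ?thesis using x a[of 0] unfolding component_def by (auto simp: a)
qed

lemma component_irreducible:
  assumes "irreducible_shift I A" "a \<in> I"
  shows "component I A a = shift_space I A"
  using assms by (auto simp: component_def irreducible_shift_def shift_space_def)

lemma ereal_le_if_real_bounds:
  fixes x y :: ereal
  assumes "\<And>s. y < ereal s \<Longrightarrow> x \<le> ereal s"
  shows "x \<le> y"
  using assms ereal_dense2[of y x] by (meson not_less)

section \<open>Pressures on compact invariant sets compared with those of loops\<close>

context shift_system
begin

lemma pressure_within_mono:
  assumes "\<eta> > 0" "X \<subseteq> \<Sigma>" "W \<subseteq> W'"
  shows "pressure_within I A X \<eta> \<psi> \<phi> W \<le> pressure_within I A X \<eta> \<psi> \<phi> W'"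
proof (rule ereal_le_if_real_bounds)
  fix s assume "pressure_within I A X \<eta> \<psi> \<phi> W' < ereal s"
  then obtain T0 where "p s summable_on {w \<in> W'. cyl w \<inter> X \<noteq> {} \<and> T0 \<le> wsum \<psi> w}"
    by (rule summable_if_pressure_less[OF assms(1,2)])
  then have "p s summable_on {w \<in> W. cyl w \<inter> X \<noteq> {} \<and> T0 \<le> wsum \<psi> w}"
    by (rule summable_on_subset_banach) (use assms(3) in auto)
  then show "pressure_within I A X \<eta> \<psi> \<phi> W \<le> ereal s"
    by (rule pressure_le_if_summable[OF assms(2)])
qed

text \<open>The first letter is locally constant and \<psi> is locally bounded below, so one
  \<open>n\<close> serves both bounds. Invariance carries the bound on the first letter to all the
  others.\<close>

lemma compact_invariant_bounds:
  assumes K: "K \<in> compact_invariant I A"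
  obtains J c where "finite J" "c > 0" "\<And>x i. x \<in> K \<Longrightarrow> x i \<in> J" "\<And>x. x \<in> K \<Longrightarrow> c \<le> \<psi> x"
proof -
  have "\<exists>k n. \<forall>y\<in>\<Sigma>. (\<forall>i<k. x i = y i) \<longrightarrow> y 0 \<le> n \<and> inverse (real (Suc n)) < \<psi> y" if x: "x \<in> \<Sigma>" for x
  proof -
    obtain k where k: "\<And>y. y \<in> \<Sigma> \<Longrightarrow> (\<forall>i<k. x i = y i) \<Longrightarrow> \<psi> x / 2 < \<psi> y"
      using \<psi>_locally_positive[OF x] by blast
    obtain m where m: "inverse (real (Suc m)) < \<psi> x / 2"
      using reals_Archimedean[of "\<psi> x / 2"] \<psi>_pos[OF x] by auto
    have "inverse (real (Suc (max m (x 0)))) \<le> inverse (real (Suc m))"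
      by (rule le_imp_inverse_le) auto
    with m have inv: "inverse (real (Suc (max m (x 0)))) < \<psi> x / 2" by linarith
    have "y 0 \<le> max m (x 0) \<and> inverse (real (Suc (max m (x 0)))) < \<psi> y"
      if y: "y \<in> \<Sigma>" "\<forall>i<Suc k. x i = y i" for y
    proof -
      have "\<psi> x / 2 < \<psi> y" using k[OF y(1)] y(2) less_SucI by blast
      moreover have "x 0 = y 0" using y(2) by blast
      ultimately show ?thesis using inv by simp
    qed
    then show ?thesis by blast
  qed
  moreover have "y 0 \<le> n \<and> inverse (real (Suc n)) < \<psi> y"
    if "y 0 \<le> m \<and> inverse (real (Suc m)) < \<psi> y" "m \<le> n" for m n y
  proof -
    have "inverse (real (Suc n)) \<le> inverse (real (Suc m))"
      by (rule le_imp_inverse_le) (use that in auto)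
    with that(1) have "inverse (real (Suc n)) < \<psi> y" by linarith
    with that show ?thesis by simp
  qed
  ultimately obtain n where n: "\<And>y. y \<in> K \<Longrightarrow> y 0 \<le> n \<and> inverse (real (Suc n)) < \<psi> y"
    by (rule compact_locally_uniform[OF K]) blast+
  have iter: "(shift ^^ k) x \<in> K" if "x \<in> K" for x k
    using that K by (induction k) (auto simp: compact_invariant_def invariant_def)
  show ?thesis
  proof (rule that)
    show "finite {..n}" "inverse (real (Suc n)) > 0" by simp_all
    show "x i \<in> {..n}" if "x \<in> K" for x i
      using n[OF iter[OF that, of i]] by (simp add: funpow_shift)
    show "inverse (real (Suc n)) \<le> \<psi> x" if "x \<in> K" for x using n[OF that] by simp
  qed
qed

lemma words_meeting_subset: "words_meeting I A X \<subseteq> words I A"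
  by (auto simp: words_meeting_def)

text \<open>\<open>K\<close> supplies a finite alphabet and the component supplies the connections
  to and from \<open>a\<close>, which is what \<open>summable_component_words\<close> asks
  for.\<close>

lemma component_pressure_le:
  assumes \<eta>: "\<eta> > 0" and K: "K \<in> compact_invariant I A"
  shows "restricted_pressure I A \<eta> K \<psi> \<phi> (words_meeting I A (component I A a))
    \<le> induced_pressure I A \<eta> \<psi> \<phi> (per_words I A a)"
proof (rule ereal_le_if_real_bounds)
  fix s assume "induced_pressure I A \<eta> \<psi> \<phi> (per_words I A a) < ereal s"
  then obtain T0 where "p s summable_on {w \<in> per_words I A a. cyl w \<inter> \<Sigma> \<noteq> {} \<and> T0 \<le> wsum \<psi> w}"
    unfolding induced_pressure_def by (rule summable_if_pressure_less[OF \<eta> order_refl])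
  moreover have "{w \<in> per_words I A a. cyl w \<inter> \<Sigma> \<noteq> {} \<and> T0 \<le> wsum \<psi> w}
      = {w \<in> per_words I A a. T0 \<le> wsum \<psi> w}"
    using periodic_in_cylinder cylinder_subset[of I A] by blast
  ultimately have loops: "p s summable_on {w \<in> per_words I A a. T0 \<le> wsum \<psi> w}" by simp
  obtain J c where J: "finite J" "\<And>x i. x \<in> K \<Longrightarrow> x i \<in> J"
    using compact_invariant_bounds[OF K] by metis
  let ?W = "words_meeting I A (component I A a) \<inter> words_meeting I A K"
  have "w \<in> words I A \<and> set w \<subseteq> J \<and> leads_to I A a (hd w) \<and> leads_to I A (last w) a"
    if "w \<in> ?W" for w
  proof -
    from that obtain x y where w: "w \<in> words I A" and x: "x \<in> cyl w" "x \<in> component I A a"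
      and y: "y \<in> cyl w" "y \<in> K"
      by (auto simp: words_meeting_def)
    have "w \<noteq> []" using w by (auto simp: words_def)
    with x(1) have "hd w = x 0" "last w = x (length w - 1)"
      by (auto simp: cylinder_def hd_conv_nth last_conv_nth)
    moreover have "w ! i \<in> J" if "i < length w" for i
      using J(2)[OF y(2), of i] y(1) that by (simp add: cylinder_def)
    ultimately show ?thesis using w x(2) by (auto simp: component_def in_set_conv_nth)
  qed
  from summable_component_words[OF loops J(1) this]
  obtain T1 where "p s summable_on {w \<in> ?W. T1 \<le> wsum \<psi> w}" by blast
  then have "p s summable_on {w \<in> ?W. cyl w \<inter> K \<noteq> {} \<and> T1 \<le> wsum \<psi> w}"
    by (rule summable_on_subset_banach) auto
  then show "restricted_pressure I A \<eta> K \<psi> \<phi> (words_meeting I A (component I A a)) \<le> ereal s"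
    unfolding restricted_pressure_def
    by (rule pressure_le_if_summable[OF compact_invariant_subset[OF K]])
qed

text \<open>\<open>K\<close> is the full subshift over a finite alphabet on which the loop series
  has no convergent tail. The periodic point of such a loop lies in both \<open>K\<close> and the
  component.\<close>

lemma component_pressure_ge:
  assumes \<eta>: "\<eta> > 0" and s: "ereal s < induced_pressure I A \<eta> \<psi> \<phi> (per_words I A a)"
  obtains K where "K \<in> compact_invariant I A"
    "ereal s \<le> restricted_pressure I A \<eta> K \<psi> \<phi> (words_meeting I A (component I A a))"
proof -
  obtain J where J: "finite J"
    "\<And>T0. \<not> p s summable_on {w \<in> per_words I A a. set w \<subseteq> J \<and> T0 \<le> wsum \<psi> w}"
    using finite_alphabet_not_summable[OF s \<eta>] by blast
  let ?K = "{x \<in> \<Sigma>. \<forall>i. x i \<in> J}"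
  have K: "?K \<in> compact_invariant I A"
    by (rule finite_alphabet_shift_compact_invariant[OF J(1)])
  let ?W = "words_meeting I A (component I A a) \<inter> words_meeting I A ?K"
  have meets: "w \<in> ?W" "cyl w \<inter> ?K \<noteq> {}" if w: "w \<in> per_words I A a" "set w \<subseteq> J" for w
  proof -
    have "w \<noteq> []" "w \<in> words I A" using w(1) by (auto simp: per_words_def words_def)
    then have "periodic w i \<in> J" for i using w(2) by (auto simp: periodic_def)
    then have "periodic w \<in> cyl w \<inter> ?K"
      using periodic_in_cylinder[OF w(1)] cylinder_subset by blast
    then show "w \<in> ?W" "cyl w \<inter> ?K \<noteq> {}"
      using periodic_in_component[OF w(1)] \<open>w \<in> words I A\<close> unfolding words_meeting_def by blast+
  qed
  have "ereal s \<le> restricted_pressure I A \<eta> ?K \<psi> \<phi> (words_meeting I A (component I A a))"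
  proof (rule ccontr)
    assume "\<not> ?thesis"
    then have "pressure_within I A ?K \<eta> \<psi> \<phi> ?W < ereal s" by (simp add: restricted_pressure_def)
    then obtain T0 where "p s summable_on {w \<in> ?W. cyl w \<inter> ?K \<noteq> {} \<and> T0 \<le> wsum \<psi> w}"
      by (rule summable_if_pressure_less[OF \<eta> compact_invariant_subset[OF K]])
    then have "p s summable_on {w \<in> per_words I A a. set w \<subseteq> J \<and> T0 \<le> wsum \<psi> w}"
      by (rule summable_on_subset_banach) (use meets in blast)
    with J(2) show False by blast
  qed
  with K show ?thesis by (rule that)
qed

lemma SUP_component_pressure:
  assumes \<eta>: "\<eta> > 0"
  shows "(SUP K\<in>compact_invariant I A.
      restricted_pressure I A \<eta> K \<psi> \<phi> (words_meeting I A (component I A a)))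
    = induced_pressure I A \<eta> \<psi> \<phi> (per_words I A a)" (is "?S = ?P")
proof (rule antisym)
  show "?S \<le> ?P" by (rule SUP_least) (rule component_pressure_le[OF \<eta>])
  show "?P \<le> ?S"
  proof (rule ccontr)
    assume "\<not> ?thesis"
    then have "?S < ?P" by (simp only: not_le)
    from ereal_dense2[OF this] obtain s where s: "?S < ereal s" "ereal s < ?P" by blast
    from component_pressure_ge[OF \<eta> s(2)] obtain K where "K \<in> compact_invariant I A"
      "ereal s \<le> restricted_pressure I A \<eta> K \<psi> \<phi> (words_meeting I A (component I A a))" .
    then have "ereal s \<le> ?S" by (rule SUP_upper2)
    with s(1) show False by simp
  qed
qed

text \<open>The words of \<open>K\<close> may run through several components;
  \<open>summable_words_meeting\<close> handles them for the upper bound, while the lower bound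
  comes from one component at a time.\<close>

lemma SUP_restricted_pressure:
  assumes \<eta>: "\<eta> > 0"
  shows "(SUP K\<in>compact_invariant I A. restricted_pressure I A \<eta> K \<psi> \<phi> (words I A))
    = (SUP a\<in>I. induced_pressure I A \<eta> \<psi> \<phi> (per_words I A a))" (is "?S = ?P")
proof (rule antisym)
  show "?P \<le> ?S"
  proof (rule SUP_least)
    fix a
    have "restricted_pressure I A \<eta> K \<psi> \<phi> (words_meeting I A (component I A a))
        \<le> restricted_pressure I A \<eta> K \<psi> \<phi> (words I A)" if "K \<in> compact_invariant I A" for K
      unfolding restricted_pressure_def using words_meeting_subset
      by (intro pressure_within_mono \<eta> compact_invariant_subset that) blast
    then show "induced_pressure I A \<eta> \<psi> \<phi> (per_words I A a) \<le> ?S"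
      unfolding SUP_component_pressure[OF \<eta>, symmetric] by (intro SUP_mono) blast
  qed
  show "?S \<le> ?P"
  proof (rule SUP_least, rule ereal_le_if_real_bounds)
    fix K s assume K: "K \<in> compact_invariant I A" and s: "?P < ereal s"
    obtain J c where Jc: "finite J" "c > 0" "\<And>x i. x \<in> K \<Longrightarrow> x i \<in> J" "\<And>x. x \<in> K \<Longrightarrow> c \<le> \<psi> x"
      using compact_invariant_bounds[OF K] by metis
    have "induced_pressure I A \<eta> \<psi> \<phi> (per_words I A a) < ereal s" if "a \<in> I" for a
      using s that by (meson SUP_upper order.strict_trans1)
    then have "p s summable_on {w. cyl w \<inter> K \<noteq> {}}"
      using Jc K compact_invariant_subset[OF K]
      by (intro summable_words_meeting[OF \<eta>, of s K J c]) (auto simp: compact_invariant_def)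
    then have "p s summable_on {w \<in> words I A \<inter> words_meeting I A K. cyl w \<inter> K \<noteq> {} \<and> 0 \<le> wsum \<psi> w}"
      by (rule summable_on_subset_banach) auto
    then show "restricted_pressure I A \<eta> K \<psi> \<phi> (words I A) \<le> ereal s"
      unfolding restricted_pressure_def
      by (rule pressure_le_if_summable[OF compact_invariant_subset[OF K]])
  qed
qed

text \<open>Under irreducibility the component of \<open>a\<close> is the whole shift, which reduces
  the claim to \<open>SUP_component_pressure\<close>.\<close>

lemma SUP_restricted_pressure_irreducible:
  assumes \<eta>: "\<eta> > 0" and irr: "irreducible_shift I A" and a: "a \<in> I"
  shows "(SUP K\<in>compact_invariant I A. restricted_pressure I A \<eta> K \<psi> \<phi> (words I A))
    = induced_pressure I A \<eta> \<psi> \<phi> (per_words I A a)"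
proof -
  have "words_meeting I A (component I A a) \<inter> words_meeting I A K = words I A \<inter> words_meeting I A K"
    for K
    unfolding component_irreducible[OF irr a] words_meeting_def
    using cylinder_subset[of I A] by blast
  then show ?thesis
    unfolding SUP_component_pressure[OF \<eta>, of a, symmetric] restricted_pressure_def by simp
qed

text \<open>Loops are words, so their pressure is at most that of all words, and a limit of
  restricted pressures never exceeds their supremum. Conversely, the supremum of a nonempty set of
  extended reals is the limit of an increasing sequence of its members.\<close>

lemma exhausting_principle_iff:
  assumes \<eta>: "\<eta> > 0"
    and SUP: "(SUP K\<in>compact_invariant I A. restricted_pressure I A \<eta> K \<psi> \<phi> (words I A))
      = induced_pressure I A \<eta> \<psi> \<phi> (per_words I A a)"
  shows "exhausting_principle I A \<eta> \<psi> \<phi> (words I A) \<longleftrightarrow>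
    induced_pressure I A \<eta> \<psi> \<phi> (words I A) = induced_pressure I A \<eta> \<psi> \<phi> (per_words I A a)"
    (is "_ \<longleftrightarrow> ?W = ?P")
proof
  let ?R = "\<lambda>K. restricted_pressure I A \<eta> K \<psi> \<phi> (words I A)"
  {
    assume "exhausting_principle I A \<eta> \<psi> \<phi> (words I A)"
    then obtain K where K: "\<And>n. K n \<in> compact_invariant I A" "(\<lambda>n. ?R (K n)) \<longlonglongrightarrow> ?W"
      by (auto simp: exhausting_principle_def)
    have "?R (K n) \<le> ?P" for n unfolding SUP[symmetric] by (rule SUP_upper[OF K(1)])
    then have "?W \<le> ?P" by (intro LIMSEQ_le_const2[OF K(2)]) blast
    moreover have "?P \<le> ?W"
      unfolding induced_pressure_def
      by (intro pressure_within_mono \<eta>) (auto simp: per_words_def)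
    ultimately show "?W = ?P" by (rule antisym)
  next
    assume eq: "?W = ?P"
    \<comment> \<open>The empty set witnesses that the family of pressures is nonempty, so that a
      sequence can be chosen from it.\<close>
    have "{} \<in> compact_invariant I A" by (simp add: compact_invariant_def invariant_def)
    then have "?R ` compact_invariant I A \<noteq> {}" by blast
    from Sup_countable_SUP[OF this] obtain f where f: "incseq f"
      "range f \<subseteq> ?R ` compact_invariant I A" "?W = (SUP n. f n)"
      unfolding eq SUP[symmetric] by blast
    then have "\<exists>K. K \<in> compact_invariant I A \<and> f n = ?R K" for n by blast
    then obtain K where K: "\<And>n. K n \<in> compact_invariant I A" "\<And>n. f n = ?R (K n)" by metis
    have "f \<longlonglongrightarrow> ?W" unfolding f(3) by (rule LIMSEQ_SUP[OF f(1)])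
    then have "(\<lambda>n. ?R (K n)) \<longlonglongrightarrow> ?W" by (simp add: K(2)[symmetric])
    with K(1) show "exhausting_principle I A \<eta> \<psi> \<phi> (words I A)"
      unfolding exhausting_principle_def by blast
  }
qed

end

theorem corollary3p23:
  fixes I :: "nat set" and A :: "nat \<Rightarrow> nat \<Rightarrow> bool"
    and \<phi> \<psi> :: "(nat \<Rightarrow> nat) \<Rightarrow> real" and \<eta> :: real
  assumes "\<eta> > 0"
    and "holder_continuous I A \<phi>"
    and "holder_continuous I A \<psi>"
    and "\<forall>x\<in>shift_space I A. \<psi> x > 0"
  shows "(\<forall>a\<in>I.
            (SUP K\<in>compact_invariant I A.
               restricted_pressure I A \<eta> K \<psi> \<phi> (words_meeting I A (component I A a)))
            = induced_pressure I A \<eta> \<psi> \<phi> (per_words I A a))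
       \<and> (SUP K\<in>compact_invariant I A. restricted_pressure I A \<eta> K \<psi> \<phi> (words I A))
            = (SUP a\<in>I. induced_pressure I A \<eta> \<psi> \<phi> (per_words I A a))
       \<and> (irreducible_shift I A \<longrightarrow>
            (\<forall>a\<in>I.
               (SUP K\<in>compact_invariant I A. restricted_pressure I A \<eta> K \<psi> \<phi> (words I A))
                 = induced_pressure I A \<eta> \<psi> \<phi> (per_words I A a)
             \<and> (exhausting_principle I A \<eta> \<psi> \<phi> (words I A) \<longleftrightarrow>
                  induced_pressure I A \<eta> \<psi> \<phi> (words I A)
                    = induced_pressure I A \<eta> \<psi> \<phi> (per_words I A a))))"
proof -
  obtain C1 where C1: "C1 \<ge> 0" "\<And>w x y. x \<in> cylinder I A w \<Longrightarrow> y \<in> cylinder I A w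
      \<Longrightarrow> \<bar>bsum \<phi> (length w) x - bsum \<phi> (length w) y\<bar> \<le> C1"
    using birkhoff_distortion[OF assms(2)] by blast
  obtain C2 where C2: "C2 \<ge> 0" "\<And>w x y. x \<in> cylinder I A w \<Longrightarrow> y \<in> cylinder I A w
      \<Longrightarrow> \<bar>bsum \<psi> (length w) x - bsum \<psi> (length w) y\<bar> \<le> C2"
    using birkhoff_distortion[OF assms(3)] by blast
  interpret shift_system I A \<phi> \<psi> "max C1 C2"
  proof
    show "\<bar>bsum f (length w) x - bsum f (length w) y\<bar> \<le> max C1 C2"
      if "f \<in> {\<phi>, \<psi>}" "x \<in> cylinder I A w" "y \<in> cylinder I A w" for f x w y
      using that C1(2)[of x w y] C2(2)[of x w y] by auto
    show "\<exists>k. \<forall>y\<in>shift_space I A. (\<forall>i<k. x i = y i) \<longrightarrow> \<psi> y > \<psi> x / 2"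
      if "x \<in> shift_space I A" for x
      using holder_locally_positive[OF assms(3) that] assms(4) that by metis
  qed (use assms(4) C1(1) in auto)
  show ?thesis
    using SUP_component_pressure[OF assms(1)] SUP_restricted_pressure[OF assms(1)]
      SUP_restricted_pressure_irreducible[OF assms(1)] exhausting_principle_iff[OF assms(1)]
    by blast
qed

end
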